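(* Let $\alpha$ be a real number with $0\le\alpha<1/2$. Then the equality $$\int_{-\infty}^{\infty}\frac{\ln\bigl|\zeta(1/2+\alpha+it)\,(-1/2+\alpha+it)\bigr|}{(1/2-\alpha)^2+t^2}\,dt=0$$ holds if and only if the Riemann zeta function $\zeta$ has no zeros $\sigma+it$ with $\sigma>1/2+\alpha$. In particular, for $\alpha=0$ this equality is equivalent to the Riemann hypothesis.
   Context: $\zeta$ denotes the Riemann zeta function. The Riemann hypothesis is the statement that $\zeta$ has no zeros with real part $>1/2$ (all non-trivial zeros lie on the line $\operatorname{Re} s=1/2$). *)

theory Defs
  imports "HOL-Complex_Analysis.Complex_Analysis"
begin

text \<open>The Riemann zeta function on \<open>\<complex> - {1}\<close>: the (unique) holomorphic function on
  \<open>\<complex> - {1}\<close> agreeing with the Dirichlet series \<open>\<Sum> n\<ge>1. n^(-s)\<close> for \<open>Re s > 1\<close>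
  (analytic continuation). Its value at the pole \<open>s = 1\<close> is unspecified.\<close>
definition riemann_zeta :: "complex \<Rightarrow> complex" where
  "riemann_zeta = (SOME f. f holomorphic_on (- {1}) \<and>
      (\<forall>s. Re s > 1 \<longrightarrow> f s = (\<Sum>n. 1 / (of_nat (Suc n)) powr s)))"

end

theory Submission
  imports Defs "HOL-Real_Asymp.Real_Asymp"
begin

text \<open>
  Put \<open>g(s) = (s - 1) \<zeta>(s)\<close>, so that \<open>g(1) = 1\<close>, and \<open>\<sigma> = 1/2 + \<alpha>\<close>. Up to a constant the weight of the
  integral is the Poisson kernel of the half-plane \<open>Re s > \<sigma>\<close> at the point \<open>1\<close>, so Jensen's inequality
  on the half-plane bounds the integral below by a multiple of \<open>ln |g(1)| = 0\<close>, strictly if \<open>g\<close> has a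
  zero to the right of the line. In the coordinate \<open>w = s - \<sigma>\<close>, the maps \<open>M\<^sub>\<epsilon>(w) = (w + \<epsilon>) / (1 + \<epsilon> w)\<close>
  with \<open>\<epsilon> > 0\<close> send the closed half-plane onto a disc in its interior, where Jensen's inequality is the
  classical one; the polynomial growth of \<open>g\<close> provides a majorant for Fatou's lemma as \<open>\<epsilon> \<rightarrow> 0\<close>.

  If \<open>g\<close> has no such zero, the mean value property holds for each \<open>\<epsilon> > 0\<close>, at every centre \<open>\<sigma> + X\<close>, and
  it remains to see that no mass is lost as \<open>\<epsilon> \<rightarrow> 0\<close>. On compact sets \<open>|g \<circ> M\<^sub>\<epsilon>|\<close> is bounded below by a
  multiple of \<open>|g|\<close>, so convergence there is dominated. The tails \<open>|t| > X\<close> are controlled by the mean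
  value at \<open>\<sigma> + X\<close>, where \<open>ln |g| \<ge> 0\<close> because \<open>\<zeta> \<ge> 1\<close> on the real axis beyond \<open>1\<close>.
\<close>

section \<open>Poisson integrals on the line\<close>

lemma fatou_integral:
  fixes u :: "nat \<Rightarrow> 'a \<Rightarrow> real"
  assumes u: "\<And>n. integrable M (u n)" "\<And>n. AE x in M. 0 \<le> u n x"
    and v: "v \<in> borel_measurable M" "AE x in M. (\<lambda>n. u n x) \<longlonglongrightarrow> v x"
    and c: "\<And>n. (\<integral>x. u n x \<partial>M) \<le> c n" "c \<longlonglongrightarrow> d"
  shows "integrable M v" "(\<integral>x. v x \<partial>M) \<le> d"
proof -
  have "AE x in M. \<forall>n. 0 \<le> u n x"
    using u(2) by (simp add: AE_all_countable)
  with v(2) have v_nonneg: "AE x in M. 0 \<le> v x"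
    by eventually_elim (auto intro: LIMSEQ_le_const)
  have "0 \<le> c n" for n
    using integral_nonneg_AE[OF u(2)] c(1) by (rule order_trans)
  then have d_nonneg: "0 \<le> d"
    using c(2) by (auto intro: LIMSEQ_le_const)
  have "(\<integral>\<^sup>+x. ennreal (v x) \<partial>M) = (\<integral>\<^sup>+x. liminf (\<lambda>n. ennreal (u n x)) \<partial>M)"
    using v(2) by (intro nn_integral_cong_AE, eventually_elim)
      (simp add: lim_imp_Liminf[symmetric] tendsto_ennrealI)
  also have "\<dots> \<le> liminf (\<lambda>n. \<integral>\<^sup>+x. ennreal (u n x) \<partial>M)"
    using borel_measurable_integrable[OF u(1)] by (intro nn_integral_liminf) auto
  also have "\<dots> \<le> liminf (\<lambda>n. ennreal (c n))"
    using c(1) by (intro Liminf_mono always_eventually allI)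
      (simp add: nn_integral_eq_integral[OF u] ennreal_leI)
  also have "\<dots> = ennreal d"
    using c(2) by (intro lim_imp_Liminf tendsto_ennrealI) auto
  finally have nn_integral_le: "(\<integral>\<^sup>+x. ennreal (v x) \<partial>M) \<le> ennreal d" .
  then show "integrable M v"
    by (intro integrableI_nonneg v v_nonneg) (auto simp: less_top[symmetric] top_unique)
  then show "(\<integral>x. v x \<partial>M) \<le> d"
    using nn_integral_le d_nonneg by (simp add: nn_integral_eq_integral[OF _ v_nonneg])
qed

lemma reverse_fatou_integral:
  fixes f :: "nat \<Rightarrow> 'a \<Rightarrow> real"
  assumes f: "\<And>n. integrable M (f n)" and h: "integrable M h" "\<And>n. AE x in M. f n x \<le> h x"
    and g: "g \<in> borel_measurable M" "AE x in M. (\<lambda>n. f n x) \<longlonglongrightarrow> g x"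
    and m: "\<And>n. m n \<le> (\<integral>x. f n x \<partial>M)" "m \<longlonglongrightarrow> l"
  shows "integrable M g" "l \<le> (\<integral>x. g x \<partial>M)"
proof -
  have diff_lim: "AE x in M. (\<lambda>n. h x - f n x) \<longlonglongrightarrow> h x - g x"
    using g(2) by eventually_elim (intro tendsto_intros)
  have diff_le: "(\<integral>x. h x - f n x \<partial>M) \<le> (\<integral>x. h x \<partial>M) - m n" for n
    using f h(1) m(1) by simp
  have bound_lim: "(\<lambda>n. (\<integral>x. h x \<partial>M) - m n) \<longlonglongrightarrow> (\<integral>x. h x \<partial>M) - l"
    by (intro tendsto_intros m)
  have diff: "integrable M (\<lambda>x. h x - g x)" "(\<integral>x. h x - g x \<partial>M) \<le> (\<integral>x. h x \<partial>M) - l"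
    using f h g(1) by (auto intro!: fatou_integral[OF _ _ _ diff_lim diff_le bound_lim])
  have "integrable M (\<lambda>x. h x - (h x - g x))"
    by (intro Bochner_Integration.integrable_diff h diff)
  then show "integrable M g"
    by simp
  then show "l \<le> (\<integral>x. g x \<partial>M)"
    using diff(2) h(1) by simp
qed

text \<open>Poisson integrals at the point \<open>x\<close> of the right half-plane, without the factor \<open>x / pi\<close>.\<close>
abbreviation poisson_integrable :: "real \<Rightarrow> (real \<Rightarrow> real) \<Rightarrow> bool" where
  "poisson_integrable x u \<equiv> integrable lborel (\<lambda>t. u t / (x\<^sup>2 + t\<^sup>2))"

abbreviation poisson_integral :: "real \<Rightarrow> (real \<Rightarrow> real) \<Rightarrow> real" where
  "poisson_integral x u \<equiv> (\<integral>t. u t / (x\<^sup>2 + t\<^sup>2) \<partial>lborel)"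

abbreviation has_poisson_integral :: "real \<Rightarrow> (real \<Rightarrow> real) \<Rightarrow> real \<Rightarrow> bool" where
  "has_poisson_integral x u \<equiv> has_bochner_integral lborel (\<lambda>t. u t / (x\<^sup>2 + t\<^sup>2))"

abbreviation log_bound :: "real \<Rightarrow> real \<Rightarrow> real \<Rightarrow> real" where
  "log_bound A B t \<equiv> A + B * ln (2 + \<bar>t\<bar>)"

lemma integrable_one_plus_abs_powr:
  assumes "p > 1"
  shows "integrable lborel (\<lambda>t::real. (1 + \<bar>t\<bar>) powr (- p))"
proof -
  define f :: "real \<Rightarrow> real" where "f x = indicator {1..} x * x powr (- p)" for x
  have "(\<lambda>x::real. x powr (- p)) absolutely_integrable_on {1..}"
    using has_integral_powr_to_inf[of "- p" 1] assms by (intro nonnegative_absolutely_integrable_1) auto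
  then have f: "integrable lborel f"
    by (simp add: set_integrable_def f_def[abs_def] integrable_completion)
  have "integrable lborel (\<lambda>t. f (1 + 1 * t) + f (1 + (- 1) * t))"
    by (intro Bochner_Integration.integrable_add lborel_integrable_real_affine f) auto
  then show ?thesis
    by (rule Bochner_Integration.integrable_bound) (auto simp: f_def indicator_def)
qed

lemma ln_one_plus_le_sqrt:
  assumes "0 \<le> (y::real)"
  shows "ln (1 + y) \<le> 2 * sqrt y"
proof -
  have "ln (1 + y) \<le> ln ((1 + sqrt y)\<^sup>2)"
    using assms by (intro ln_mono) (auto simp: power2_sum add_nonneg_pos)
  also have "\<dots> = 2 * ln (1 + sqrt y)"
    using assms by (simp add: ln_realpow add_pos_nonneg)
  also have "\<dots> \<le> 2 * sqrt y"
    using assms by (simp add: ln_add_one_self_le_self)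
  finally show ?thesis .
qed

lemma poisson_integrable_log_bound:
  fixes A B b :: real
  assumes b: "b > 0"
  shows "poisson_integrable b (log_bound A B)"
proof (rule Bochner_Integration.integrable_bound)
  define M where "M = (\<bar>A\<bar> + \<bar>B\<bar> * 2) * (2 * (1 + 1 / b\<^sup>2))"
  show "integrable lborel (\<lambda>t. M * (1 + \<bar>t\<bar>) powr (- (3/2)))"
    by (intro integrable_mult_right integrable_one_plus_abs_powr) simp
  have "\<bar>log_bound A B t\<bar> / (b\<^sup>2 + t\<^sup>2) \<le> M * (1 + \<bar>t\<bar>) powr (- (3/2))" for t
  proof -
    define y where "y = 1 + \<bar>t\<bar>"
    have y: "y \<ge> 1" and y_eq: "2 + \<bar>t\<bar> = 1 + y" by (auto simp: y_def)
    have "\<bar>log_bound A B t\<bar> \<le> \<bar>A\<bar> * 1 + \<bar>B\<bar> * ln (1 + y)"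
      using abs_triangle_ineq[of A "B * ln (1 + y)"] y unfolding y_eq by (simp add: abs_mult)
    also have "\<dots> \<le> \<bar>A\<bar> * sqrt y + \<bar>B\<bar> * (2 * sqrt y)"
      using y by (intro add_mono mult_left_mono ln_one_plus_le_sqrt) auto
    finally have log_le: "\<bar>log_bound A B t\<bar> \<le> (\<bar>A\<bar> + \<bar>B\<bar> * 2) * sqrt y"
      by (simp add: algebra_simps)
    have "y\<^sup>2 \<le> 2 + 2 * t\<^sup>2"
      using zero_le_power2[of "1 - \<bar>t\<bar>"] by (simp add: y_def power2_eq_square algebra_simps)
    also have "\<dots> \<le> 2 * (1 + 1 / b\<^sup>2) * (b\<^sup>2 + t\<^sup>2)"
      using b by (simp add: field_simps)
    finally have kernel_le: "1 / (b\<^sup>2 + t\<^sup>2) \<le> 2 * (1 + 1 / b\<^sup>2) / y\<^sup>2"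
      using b y by (simp add: field_simps add_pos_nonneg)
    have "\<bar>log_bound A B t\<bar> * (1 / (b\<^sup>2 + t\<^sup>2))
        \<le> ((\<bar>A\<bar> + \<bar>B\<bar> * 2) * sqrt y) * (2 * (1 + 1 / b\<^sup>2) / y\<^sup>2)"
      using y by (intro mult_mono log_le kernel_le) auto
    also have "\<dots> = M * (sqrt y / y\<^sup>2)"
      by (simp add: M_def)
    also have "sqrt y / y\<^sup>2 = y powr (1/2 - 2)"
      using y by (subst powr_diff) (simp add: powr_half_sqrt powr_numeral)
    finally show ?thesis by (simp add: y_def)
  qed
  then show "AE t in lborel. norm (log_bound A B t / (b\<^sup>2 + t\<^sup>2)) \<le> norm (M * (1 + \<bar>t\<bar>) powr (- (3/2)))"
    by (intro AE_I2) (auto simp: M_def abs_mult)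
qed measurable

lemma poisson_integral_log_bound_tendsto_0:
  fixes A B :: real
  shows "((\<lambda>X. poisson_integral X (log_bound A B)) \<longlongrightarrow> 0) at_top"
proof -
  let ?D = "\<lambda>t::real. log_bound A B t"
  have "((\<lambda>X. \<integral>t. ?D t / (X\<^sup>2 + t\<^sup>2) \<partial>lborel) \<longlongrightarrow> integral\<^sup>L lborel (\<lambda>t::real. 0)) at_top"
  proof (rule integral_dominated_convergence_at_top)
    show "integrable lborel (\<lambda>t. \<bar>?D t / (1\<^sup>2 + t\<^sup>2)\<bar>)"
      by (intro integrable_abs poisson_integrable_log_bound) simp
    have "norm (?D t / (X\<^sup>2 + t\<^sup>2)) \<le> \<bar>?D t / (1\<^sup>2 + t\<^sup>2)\<bar>" if "X \<ge> 1" for X t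
      using that power_mono[of 1 X 2]
      by (auto simp: abs_divide intro!: divide_left_mono mult_pos_pos add_pos_nonneg)
    then show "\<forall>\<^sub>F X in at_top. AE t in lborel. norm (?D t / (X\<^sup>2 + t\<^sup>2)) \<le> \<bar>?D t / (1\<^sup>2 + t\<^sup>2)\<bar>"
      by (intro eventually_at_top_linorderI[of 1] AE_I2)
    have "((\<lambda>X. ?D t / (X\<^sup>2 + t\<^sup>2)) \<longlongrightarrow> 0) at_top" for t
      by real_asymp
    then show "AE t in lborel. ((\<lambda>X. ?D t / (X\<^sup>2 + t\<^sup>2)) \<longlongrightarrow> 0) at_top"
      by simp
  qed measurable
  then show ?thesis by simp
qed

lemma poisson_kernel_tail_le:
  fixes b t X :: real
  assumes X: "0 < X" and t: "X < \<bar>t\<bar>"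
  shows "1 / (b\<^sup>2 + t\<^sup>2) \<le> 2 / (X\<^sup>2 + t\<^sup>2)"
proof -
  have "X\<^sup>2 \<le> t\<^sup>2"
    using assms by (simp add: abs_le_square_iff[symmetric])
  then have "X\<^sup>2 + t\<^sup>2 \<le> 2 * (b\<^sup>2 + t\<^sup>2)"
    using zero_le_power2[of b] unfolding distrib_left by linarith
  moreover have "0 < t\<^sup>2"
    using assms by auto
  ultimately show ?thesis
    by (simp add: divide_simps add_nonneg_pos mult.commute)
qed

lemma poisson_integral_tail_le:
  fixes u D :: "real \<Rightarrow> real"
  assumes X: "0 < X" and u_le: "\<And>t. u t \<le> D t" "\<And>t. 0 \<le> D t"
    and u: "poisson_integrable b u" "poisson_integrable X u"
    and D: "poisson_integrable X D"
  shows "\<bar>poisson_integral b u - (LBINT t:{-X..X}. u t / (b\<^sup>2 + t\<^sup>2))\<bar>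
    \<le> 4 * poisson_integral X D - 2 * poisson_integral X u"
proof -
  define v where "v t = u t / (b\<^sup>2 + t\<^sup>2) - indicat_real {-X..X} t * (u t / (b\<^sup>2 + t\<^sup>2))" for t
  have restricted: "integrable lborel (\<lambda>t. indicat_real {-X..X} t * (u t / (b\<^sup>2 + t\<^sup>2)))"
    using integrable_real_mult_indicator[OF _ u(1), of "{-X..X}"] by (simp add: mult.commute)
  have abs_v_le: "\<bar>v t\<bar> \<le> 4 * (D t / (X\<^sup>2 + t\<^sup>2)) - 2 * (u t / (X\<^sup>2 + t\<^sup>2))" for t
  proof -
    have "\<bar>v t\<bar> \<le> \<bar>u t\<bar> * (2 / (X\<^sup>2 + t\<^sup>2))"
    proof (cases "t \<in> {-X..X}")
      case False
      then have "\<bar>u t\<bar> * (1 / (b\<^sup>2 + t\<^sup>2)) \<le> \<bar>u t\<bar> * (2 / (X\<^sup>2 + t\<^sup>2))"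
        by (intro mult_left_mono poisson_kernel_tail_le X) auto
      then show ?thesis using False by (simp add: v_def abs_divide)
    qed (simp add: v_def)
    also have "\<dots> \<le> (2 * D t - u t) * (2 / (X\<^sup>2 + t\<^sup>2))"
      using u_le[of t] by (intro mult_right_mono) auto
    finally show ?thesis by (simp add: algebra_simps diff_divide_distrib)
  qed
  have "\<bar>\<integral>t. v t \<partial>lborel\<bar> \<le> (\<integral>t. 4 * (D t / (X\<^sup>2 + t\<^sup>2)) - 2 * (u t / (X\<^sup>2 + t\<^sup>2)) \<partial>lborel)"
    using u D restricted abs_v_le unfolding v_def
    by (intro integral_abs_bound[THEN order_trans] integral_mono integrable_abs
        Bochner_Integration.integrable_diff integrable_mult_right) auto
  then show ?thesis
    using u D restricted
    by (simp add: v_def set_lebesgue_integral_def Bochner_Integration.integral_diff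
        integral_mult_right integrable_mult_right del: times_divide_eq_right)
qed

section \<open>Factoring out zeros of holomorphic functions\<close>

lemma open_Re_gt: "open {s. Re s > a}" and connected_Re_gt: "connected {s. Re s > a}"
  by (auto simp: open_halfspace_Re_gt intro: convex_connected convex_halfspace_Re_gt)

lemma holomorphic_remove_zero:
  assumes f: "f holomorphic_on S" "open S" "connected S"
    and w: "w \<in> S" "f w = 0" and z0: "z0 \<in> S" "f z0 \<noteq> 0"
  obtains q n where "q holomorphic_on S" "q w \<noteq> 0" "(0::nat) < n" "\<And>z. z \<in> S \<Longrightarrow> f z = (z - w) ^ n * q z"
proof -
  have "\<not> f constant_on S" unfolding constant_on_def using w z0 by metis
  then obtain g r n where n: "0 < n" and r: "0 < r" "ball w r \<subseteq> S" and g: "g holomorphic_on ball w r"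
    and f_eq: "\<And>z. z \<in> ball w r \<Longrightarrow> f z = (z - w) ^ n * g z" and g_nz: "\<And>z. z \<in> ball w r \<Longrightarrow> g z \<noteq> 0"
    using holomorphic_factor_zero_nonconstant[OF f w] by metis
  define q where "q z = (if z \<in> ball w r then g z else f z / (z - w) ^ n)" for z
  have q_ball: "q holomorphic_on ball w r"
    using g by (rule holomorphic_transform) (simp add: q_def)
  have "(\<lambda>z. f z / (z - w) ^ n) holomorphic_on S - {w}"
    by (intro holomorphic_intros holomorphic_on_subset[OF f(1)]) auto
  then have q_punctured: "q holomorphic_on S - {w}"
    by (rule holomorphic_transform) (auto simp: q_def f_eq)
  have "q holomorphic_on (ball w r \<union> (S - {w}))"
    by (rule holomorphic_on_Un[OF q_ball q_punctured]) (use f in auto)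
  also have "ball w r \<union> (S - {w}) = S" using r w by (auto simp: subset_eq)
  finally have "q holomorphic_on S" .
  moreover have "q w \<noteq> 0" using r g_nz by (simp add: q_def)
  moreover have "f z = (z - w) ^ n * q z" if "z \<in> S" for z
    using f_eq that r n by (cases "z = w") (auto simp: q_def)
  ultimately show ?thesis using n that by blast
qed

lemma holomorphic_finite_zeros_compact:
  assumes f: "f holomorphic_on S" "open S" "connected S" and K: "compact K" "K \<subseteq> S"
    and z0: "z0 \<in> S" "f z0 \<noteq> 0"
  shows "finite {z\<in>K. f z = 0}"
proof (cases "f constant_on S")
  case True
  then have "{z\<in>K. f z = 0} = {}"
    using K z0 by (auto simp: constant_on_def)
  then show ?thesis by (simp only: finite.emptyI)
qed (rule holomorphic_compact_finite_zeros[OF f K])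

lemma holomorphic_factor_zeros_compact:
  assumes f: "f holomorphic_on S" and S: "open S" "connected S" and K: "compact K" "K \<subseteq> S"
    and z0: "z0 \<in> S" "f z0 \<noteq> 0"
  obtains Z n h where "finite Z" "Z \<subseteq> {z\<in>K. f z = 0}" "h holomorphic_on S" "\<And>z. z \<in> K \<Longrightarrow> h z \<noteq> 0"
    "\<And>z. z \<in> S \<Longrightarrow> f z = h z * (\<Prod>w\<in>Z. (z - w) ^ n w)"
  using f z0
proof (induction "card {z\<in>K. f z = 0}" arbitrary: f z0 thesis)
  case 0
  then have "{z\<in>K. f z = 0} = {}"
    using holomorphic_finite_zeros_compact[OF "0.prems"(2) S K "0.prems"(3,4)] by simp
  then show ?case
    by (intro "0.prems"(1)[of "{}" f]) (use 0 in auto)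
next
  case (Suc N)
  have "{z\<in>K. f z = 0} \<noteq> {}" using Suc.hyps(2) by (metis card.empty nat.distinct(1))
  then obtain w where w: "w \<in> K" "f w = 0" by auto
  with K have "w \<in> S" by auto
  obtain q n where q: "q holomorphic_on S" "q w \<noteq> 0" "(0::nat) < n" "\<And>z. z \<in> S \<Longrightarrow> f z = (z - w) ^ n * q z"
    using holomorphic_remove_zero[OF Suc.prems(2) S \<open>w \<in> S\<close> w(2) Suc.prems(3,4)] by metis
  have zeros: "{z\<in>K. f z = 0} = insert w {z\<in>K. q z = 0}"
    using q K w by auto
  have "N = card {z\<in>K. q z = 0}"
    using Suc.hyps(2) q(2) holomorphic_finite_zeros_compact[OF q(1) S K \<open>w \<in> S\<close> q(2)]
    unfolding zeros by simp
  then obtain Z m h where Z: "finite Z" "Z \<subseteq> {z\<in>K. q z = 0}" and h: "h holomorphic_on S" "\<And>z. z \<in> K \<Longrightarrow> h z \<noteq> 0"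
    and q_eq: "\<And>z. z \<in> S \<Longrightarrow> q z = h z * (\<Prod>v\<in>Z. (z - v) ^ m v)"
    using Suc.hyps(1)[OF _ _ q(1) \<open>w \<in> S\<close> q(2)] by blast
  have "w \<notin> Z" using Z(2) q(2) by auto
  then have "(\<Prod>v\<in>Z. (z - v) ^ (m(w := n)) v) = (\<Prod>v\<in>Z. (z - v) ^ m v)" for z
    by (intro prod.cong) auto
  then have "f z = h z * (\<Prod>v\<in>insert w Z. (z - v) ^ (m(w := n)) v)" if "z \<in> S" for z
    using q(4)[OF that] q_eq[OF that] Z(1) \<open>w \<notin> Z\<close> by simp
  moreover have "insert w Z \<subseteq> {z\<in>K. f z = 0}"
    using Z(2) zeros by blast
  ultimately show ?case
    using Suc.prems(1)[of "insert w Z" h "m(w := n)"] Z(1) h by blast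
qed

lemma holomorphic_comparable_zero_product:
  assumes f: "f holomorphic_on S" and S: "open S" "connected S" and K: "compact K" "K \<subseteq> S"
    and z0: "z0 \<in> S" "f z0 \<noteq> 0"
  obtains Z n C where "Z \<subseteq> {z\<in>K. f z = 0}" "C > 0"
    "\<And>z. z \<in> K \<Longrightarrow> norm (f z) \<le> C * (\<Prod>w\<in>Z. norm (z - w) ^ n w)"
    "\<And>z. z \<in> K \<Longrightarrow> (\<Prod>w\<in>Z. norm (z - w) ^ n w) \<le> C * norm (f z)"
proof -
  obtain Z h n where Z: "finite Z" "Z \<subseteq> {z\<in>K. f z = 0}"
    and h: "h holomorphic_on S" "\<And>z. z \<in> K \<Longrightarrow> h z \<noteq> 0"
    and f_eq: "\<And>z. z \<in> S \<Longrightarrow> f z = h z * (\<Prod>w\<in>Z. (z - w) ^ n w)"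
    by (rule holomorphic_factor_zeros_compact[OF f S K z0]) (rule that)
  define P where "P z = (\<Prod>w\<in>Z. norm (z - w) ^ n w)" for z
  have P_nonneg: "0 \<le> P z" for z
    unfolding P_def by (intro prod_nonneg) auto
  have norm_f: "norm (f z) = norm (h z) * P z" if "z \<in> K" for z
    using that K(2) f_eq[of z] by (auto simp: P_def norm_mult prod_norm[symmetric] norm_power)
  have h_cont: "continuous_on K h"
    using h(1) K(2) by (intro holomorphic_on_imp_continuous_on) (rule holomorphic_on_subset)
  obtain M where M: "0 \<le> M" "\<And>z. z \<in> K \<Longrightarrow> norm (h z) \<le> M"
    using continuous_on_compact_bound[OF K(1) h_cont] by metis
  have "continuous_on K (\<lambda>z. 1 / h z)"
    using h(2) by (intro continuous_intros h_cont) auto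
  then obtain m where m: "0 \<le> m" "\<And>z. z \<in> K \<Longrightarrow> norm (1 / h z) \<le> m"
    using continuous_on_compact_bound[OF K(1)] by metis
  show ?thesis
  proof (rule that[of Z "max M m + 1" n, folded P_def])
    show "norm (f z) \<le> (max M m + 1) * P z" if "z \<in> K" for z
      unfolding norm_f[OF that] using M(2)[OF that] by (intro mult_right_mono P_nonneg) auto
    show "P z \<le> (max M m + 1) * norm (f z)" if "z \<in> K" for z
    proof -
      have "P z = norm (1 / h z) * norm (f z)"
        using h(2)[OF that] by (simp add: norm_f[OF that] norm_divide)
      also have "\<dots> \<le> (max M m + 1) * norm (f z)"
        using m(2)[OF that] by (intro mult_right_mono) auto
      finally show ?thesis .
    qed
  qed (use Z M(1) in auto)
qed

lemma open_imp_fsigma: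
  fixes S :: "'a::euclidean_space set"
  assumes "open S"
  shows "fsigma S"
proof -
  obtain C :: "nat \<Rightarrow> 'a set" where "\<And>n. compact (C n)" "\<Union>(range C) = S"
    using open_Union_compact_subsets[OF assms] by metis
  then show ?thesis
    using fsigma.intros[of C] compact_imp_closed by metis
qed

lemma AE_holomorphic_comp_inj_nonzero:
  assumes f: "f holomorphic_on S" "open S" "connected S" and z0: "z0 \<in> S" "f z0 \<noteq> 0"
    and \<gamma>: "range \<gamma> \<subseteq> S" "inj \<gamma>"
  shows "AE t in (lborel :: real measure). f (\<gamma> t) \<noteq> 0"
proof (cases "f constant_on S")
  case True
  then have "f (\<gamma> t) = f z0" for t
    using z0 \<gamma>(1) unfolding constant_on_def by (metis range_subsetD)
  with z0 show ?thesis by simp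
next
  case False
  have "countable {z\<in>S. f z = 0}"
    using f False by (intro holomorphic_countable_zeros) (auto intro: open_imp_fsigma)
  then have "countable (\<gamma> ` (\<gamma> -` {z\<in>S. f z = 0}))"
    by (rule countable_subset[rotated]) auto
  then have "countable (\<gamma> -` {z\<in>S. f z = 0})"
    by (rule countable_image_inj_on) (rule inj_on_subset[OF \<gamma>(2) subset_UNIV])
  then have "\<gamma> -` {z\<in>S. f z = 0} \<in> null_sets lborel"
    by (rule countable_imp_null_set_lborel)
  then show ?thesis
    by (rule AE_not_in[THEN AE_mp]) (use \<gamma>(1) in auto)
qed

section \<open>Jensen's inequality on the unit disc\<close>

definition cayley :: "real \<Rightarrow> complex \<Rightarrow> complex" where
  "cayley b w = (w - of_real b) / (w + of_real b)"

lemma cayley_cis: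
  assumes "b > 0"
  shows "cis (pi - 2 * arctan (t / b)) = cayley b (\<i> * of_real t)"
proof -
  define \<theta> where "\<theta> = arctan (t / b)"
  have tan_eq: "of_real (tan \<theta>) = (of_real t / of_real b :: complex)" and cos_pos: "cos \<theta> > 0"
    using cos_gt_zero_pi[OF arctan_lbound arctan_ubound] by (simp_all add: \<theta>_def tan_arctan)
  have cis_eq: "cis \<theta> = of_real (cos \<theta>) * (1 + \<i> * of_real (tan \<theta>))"
     "cis (- \<theta>) = of_real (cos \<theta>) * (1 - \<i> * of_real (tan \<theta>))"
    using cos_pos by (simp_all add: complex_eq_iff tan_def)
  have "cis (pi - 2 * \<theta>) = - (cis (- \<theta>) / cis \<theta>)"
    by (simp add: cis_divide complex_eq_iff)
  also have "\<dots> = - ((1 - \<i> * (of_real t / of_real b)) / (1 + \<i> * (of_real t / of_real b)))"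
    using cos_pos unfolding cis_eq tan_eq by simp
  also have "\<dots> = - ((of_real b - \<i> * of_real t) / (of_real b + \<i> * of_real t))"
    using assms by (simp add: divide_simps)
  also have "\<dots> = cayley b (\<i> * of_real t)"
    by (simp add: cayley_def minus_divide_left add.commute)
  finally show ?thesis by (simp add: \<theta>_def)
qed

lemma imaginary_plus_real_nonzero: "b > 0 \<Longrightarrow> \<i> * of_real t + of_real b \<noteq> 0"
  by (simp add: complex_eq_iff)

lemma inj_cayley_imaginary:
  assumes "b > 0"
  shows "inj (\<lambda>t. cayley b (\<i> * of_real t))"
proof (rule injI)
  fix s t
  assume "cayley b (\<i> * of_real s) = cayley b (\<i> * of_real t)"
  then have "(\<i> * of_real s - of_real b) * (\<i> * of_real t + of_real b)
      = (\<i> * of_real t - of_real b) * (\<i> * of_real s + of_real b)"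
    using assms by (simp add: cayley_def frac_eq_eq imaginary_plus_real_nonzero)
  then show "s = t"
    using assms by (simp add: complex_eq_iff)
qed

lemma norm_cayley_imaginary: "b > 0 \<Longrightarrow> norm (cayley b (\<i> * of_real t)) = 1"
  by (simp flip: cayley_cis)

lemma continuous_on_cayley_imaginary:
  assumes "b > 0"
  shows "continuous_on UNIV (\<lambda>t. cayley b (\<i> * of_real t))"
proof -
  have "\<forall>t. \<i> * of_real t + of_real b \<noteq> 0"
    using imaginary_plus_real_nonzero[OF assms] by blast
  then show ?thesis unfolding cayley_def by (intro continuous_intros) auto
qed

lemma borel_measurable_comp_cayley:
  assumes "continuous_on S f" "sphere 0 1 \<subseteq> S" "b > 0"
  shows "(\<lambda>t. f (cayley b (\<i> * of_real t))) \<in> borel_measurable borel"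
proof (rule borel_measurable_continuous_onI)
  show "continuous_on UNIV (\<lambda>t. f (cayley b (\<i> * of_real t)))"
    using assms by (intro continuous_on_compose2[OF assms(1) continuous_on_cayley_imaginary])
      (auto simp: norm_cayley_imaginary)
qed

lemma mean_value_cis:
  fixes f :: "complex \<Rightarrow> complex"
  assumes f: "f holomorphic_on cball 0 1"
  shows "((\<lambda>t. f (cis t)) has_integral 2 * pi * f 0) {0..2*pi}"
proof -
  have "((\<lambda>u. f u / (u - 0)) has_contour_integral (2 * of_real pi * \<i> * f 0)) (circlepath 0 1)"
    by (rule Cauchy_integral_circlepath_simple[OF f]) simp
  then have "((\<lambda>t. f (cis t) / cis t * \<i> * cis t) has_integral 2 * of_real pi * \<i> * f 0) {0..2*pi}"
    unfolding circlepath_def by (subst (asm) has_contour_integral_part_circlepath_iff) auto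
  from has_integral_mult_right[OF this, of "- \<i>"] show ?thesis
    by (simp add: field_simps)
qed

lemma range_pi_minus_two_arctan:
  assumes "b > 0"
  shows "range (\<lambda>t. pi - 2 * arctan (t / b)) = {0<..<2*pi}"
proof safe
  fix t
  show "pi - 2 * arctan (t / b) \<in> {0<..<2*pi}"
    using arctan_bounded[of "t / b"] by auto
next
  fix y :: real
  assume "y \<in> {0<..<2*pi}"
  then have "y = pi - 2 * arctan (b * tan ((pi - y) / 2) / b)"
    using assms by (simp add: arctan_tan diff_divide_distrib)
  then show "y \<in> range (\<lambda>t. pi - 2 * arctan (t / b))" by blast
qed

lemma has_field_derivative_pi_minus_two_arctan:
  assumes "b > 0"
  shows "((\<lambda>t. pi - 2 * arctan (t / b)) has_field_derivative - (2 * b / (b\<^sup>2 + t\<^sup>2))) (at t within A)"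
proof -
  have "((\<lambda>t. pi - 2 * arctan (t / b)) has_field_derivative (0 - 2 * (inverse (1 + (t / b)\<^sup>2) * (1 / b))))
      (at t within A)"
    using assms by (auto intro!: derivative_eq_intros)
  also have "0 - 2 * (inverse (1 + (t / b)\<^sup>2) * (1 / b)) = - (2 * b / (b\<^sup>2 + t\<^sup>2))"
    using assms by (simp add: divide_simps power2_eq_square)
  finally show ?thesis .
qed

lemma has_poisson_integral_cayley:
  fixes u :: "complex \<Rightarrow> real"
  assumes u: "continuous_on (sphere 0 1) u" and b: "b > 0"
  shows "has_poisson_integral b (\<lambda>t. u (cayley b (\<i> * of_real t)))
      (integral {0..2*pi} (\<lambda>t. u (cis t)) / (2 * b))"
proof -
  let ?I = "integral {0..2*pi} (\<lambda>t. u (cis t))"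
  define g where "g t = pi - 2 * arctan (t / b)" for t
  define g' where "g' t = - (2 * b / (b\<^sup>2 + t\<^sup>2))" for t
  define k where "k t = 2 * b * (u (cayley b (\<i> * of_real t)) / (b\<^sup>2 + t\<^sup>2))" for t
  have range_g: "range g = {0<..<2*pi}"
    unfolding g_def by (rule range_pi_minus_two_arctan[OF b])
  have "continuous_on {0..2*pi} (\<lambda>t. u (cis t))"
    by (intro continuous_on_compose2[OF u] continuous_intros) auto
  then have "(\<lambda>t. u (cis t)) absolutely_integrable_on {0..2*pi}"
    by (rule absolutely_integrable_continuous_real)
  then have "(\<lambda>t. u (cis t)) absolutely_integrable_on range g \<and> integral (range g) (\<lambda>t. u (cis t)) = ?I"
    unfolding range_g integral_open_interval_real by (auto intro: set_integrable_subset)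
  moreover have "(g has_field_derivative g' t) (at t within UNIV)" for t
    unfolding g_def g'_def by (rule has_field_derivative_pi_minus_two_arctan[OF b])
  moreover have "inj g"
    unfolding g_def using b by (auto intro!: injI simp: arctan_eq_iff)
  ultimately have "(\<lambda>t. \<bar>g' t\<bar> * u (cis (g t))) absolutely_integrable_on UNIV \<and>
      integral UNIV (\<lambda>t. \<bar>g' t\<bar> * u (cis (g t))) = ?I"
    by (subst has_absolute_integral_change_of_variables_1') auto
  moreover have "(\<lambda>t. \<bar>g' t\<bar> * u (cis (g t))) = k"
    using b by (auto simp: g_def g'_def k_def cayley_cis)
  ultimately have "k absolutely_integrable_on UNIV" "integral UNIV k = ?I"
    by simp_all
  moreover have "k \<in> borel_measurable borel"
    unfolding k_def using borel_measurable_comp_cayley[OF u _ b] by measurable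
  ultimately have "has_bochner_integral lborel k ?I"
    by (simp add: has_bochner_integral_iff set_integrable_def integrable_completion
        integral_lebesgue integral_completion)
  then have "has_bochner_integral lborel (\<lambda>t. k t / (2 * b)) (?I / (2 * b))"
    by (rule has_bochner_integral_divide_zero)
  then show ?thesis using b by (simp add: k_def)
qed

abbreviation cayley_log :: "real \<Rightarrow> (complex \<Rightarrow> complex) \<Rightarrow> real \<Rightarrow> real" where
  "cayley_log x F t \<equiv> ln (norm (F (cayley x (\<i> * of_real t))))"

lemma ln_norm_mean_value_cayley:
  assumes F: "F holomorphic_on cball 0 1" "\<And>z. z \<in> cball 0 1 \<Longrightarrow> F z \<noteq> 0" and b: "b > 0"
  shows "has_poisson_integral b (cayley_log b F) (pi / b * ln (norm (F 0)))"
proof -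
  obtain L where L: "L holomorphic_on cball 0 1" "\<And>z. z \<in> cball 0 1 \<Longrightarrow> F z = exp (L z)"
    using contractible_imp_holomorphic_log[OF F(1) convex_imp_contractible[OF convex_cball] F(2)] by metis
  have ln_F: "ln (norm (F z)) = Re (L z)" if "z \<in> cball 0 1" for z
    using L(2)[OF that] by simp
  have "continuous_on (sphere 0 1) (\<lambda>z. Re (L z))"
    by (intro continuous_intros continuous_on_subset[OF holomorphic_on_imp_continuous_on[OF L(1)]]) auto
  from has_poisson_integral_cayley[OF this b]
  have "has_poisson_integral b (\<lambda>t. Re (L (cayley b (\<i> * of_real t))))
      (integral {0..2*pi} (\<lambda>t. Re (L (cis t))) / (2 * b))" .
  moreover have "integral {0..2*pi} (\<lambda>t. Re (L (cis t))) = 2 * pi * Re (L 0)"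
    using has_integral_Re[OF mean_value_cis[OF L(1)]] by (simp add: integral_unique mult.assoc)
  ultimately show ?thesis
    using b by (simp add: ln_F norm_cayley_imaginary)
qed

lemma analytic_on_connected_extend:
  fixes f :: "complex \<Rightarrow> complex"
  assumes f: "f analytic_on K" and K: "connected K" "a \<in> K"
  obtains S where "open S" "connected S" "K \<subseteq> S" "f holomorphic_on S"
proof -
  obtain S where S: "open S" "K \<subseteq> S" "f holomorphic_on S"
    using f unfolding analytic_on_holomorphic by blast
  show ?thesis
  proof (rule that[of "connected_component_set S a"])
    show "open (connected_component_set S a)"
      using S(1) by (rule open_connected_component)
    show "K \<subseteq> connected_component_set S a"
      using K S(2) by (intro connected_component_maximal)
    show "f holomorphic_on connected_component_set S a"
      using S(3) connected_component_subset by (rule holomorphic_on_subset)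
  qed simp
qed

lemma norm_one_minus_cnj_mult:
  fixes w z :: complex
  assumes "norm z = 1"
  shows "norm (1 - cnj w * z) = norm (z - w)"
proof -
  have "1 - cnj w * z = z * cnj (z - w)"
    using assms complex_norm_square[of z] by (simp add: algebra_simps)
  then show ?thesis using assms by (simp add: norm_mult del: complex_cnj_diff)
qed

text \<open>Replacing each factor \<open>z - w\<close> with \<open>\<bar>w\<bar> < 1\<close> by \<open>1 - cnj w * z\<close> keeps the modulus on the
  circle and can only increase it at \<open>0\<close>.\<close>
lemma reflect_zeros_disc:
  assumes F: "F analytic_on cball 0 1" and nz: "\<And>z. norm z = 1 \<Longrightarrow> F z \<noteq> 0"
  obtains H where "H holomorphic_on cball 0 1" "\<And>z. z \<in> cball 0 1 \<Longrightarrow> H z \<noteq> 0"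
    "\<And>z. norm z = 1 \<Longrightarrow> norm (H z) = norm (F z)" "norm (F 0) \<le> norm (H 0)"
proof -
  obtain S where S: "open S" "connected S" "cball 0 1 \<subseteq> S" "F holomorphic_on S"
    using analytic_on_connected_extend[OF F connected_cball] by (metis centre_in_cball zero_le_one)
  obtain Z n h where Z: "finite Z" "Z \<subseteq> {z\<in>cball 0 1. F z = 0}"
    and h: "h holomorphic_on S" "\<And>z. z \<in> cball 0 1 \<Longrightarrow> h z \<noteq> 0"
    and F_eq: "\<And>z. z \<in> S \<Longrightarrow> F z = h z * (\<Prod>w\<in>Z. (z - w) ^ n w)"
    by (rule holomorphic_factor_zeros_compact[OF S(4,1,2) compact_cball S(3), of 1])
      (use S(3) nz[of 1] in auto)
  have norm_Z: "norm w < 1" if "w \<in> Z" for w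
    using that Z(2) nz[of w] by (force simp: less_le)
  define H where "H z = h z * (\<Prod>w\<in>Z. (1 - cnj w * z) ^ n w)" for z
  show ?thesis
  proof (rule that)
    show "H holomorphic_on cball 0 1"
      unfolding H_def by (intro holomorphic_intros holomorphic_on_subset[OF h(1) S(3)])
    show "H z \<noteq> 0" if z: "z \<in> cball 0 1" for z
    proof -
      have "cnj w * z \<noteq> 1" if "w \<in> Z" for w
      proof -
        have "norm (cnj w * z) \<le> norm w * 1"
          using z unfolding norm_mult complex_mod_cnj by (intro mult_left_mono) auto
        then show ?thesis using norm_Z[OF that] by auto
      qed
      then show ?thesis using h(2)[OF z] Z(1) by (auto simp: H_def)
    qed
    show "norm (H z) = norm (F z)" if "norm z = 1" for z
      using that S(3) F_eq[of z]
      by (auto simp: H_def norm_mult prod_norm[symmetric] norm_power norm_one_minus_cnj_mult subset_eq)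
    have "norm (F 0) = norm (h 0) * (\<Prod>w\<in>Z. norm w ^ n w)"
      using S(3) F_eq[of 0] by (auto simp: norm_mult prod_norm[symmetric] norm_power subset_eq)
    also have "\<dots> \<le> norm (h 0) * 1"
      using norm_Z by (intro mult_left_mono prod_le_1) (auto intro!: power_le_one intro: less_imp_le)
    finally show "norm (F 0) \<le> norm (H 0)" by (simp add: H_def)
  qed
qed

lemma jensen_cayley_nonzero_sphere:
  assumes F: "F analytic_on cball 0 1" "\<And>z. norm z = 1 \<Longrightarrow> F z \<noteq> 0" "F 0 \<noteq> 0" and b: "b > 0"
  shows "poisson_integrable b (cayley_log b F)"
    and "pi / b * ln (norm (F 0)) \<le> poisson_integral b (cayley_log b F)"
proof -
  obtain H where H: "H holomorphic_on cball 0 1" "\<And>z. z \<in> cball 0 1 \<Longrightarrow> H z \<noteq> 0"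
    and H_sphere: "\<And>z. norm z = 1 \<Longrightarrow> norm (H z) = norm (F z)" and H_0: "norm (F 0) \<le> norm (H 0)"
    using reflect_zeros_disc[OF F(1,2)] by metis
  have "has_poisson_integral b (cayley_log b F) (pi / b * ln (norm (H 0)))"
    using ln_norm_mean_value_cayley[OF H b] b by (simp add: H_sphere norm_cayley_imaginary)
  moreover have "pi / b * ln (norm (F 0)) \<le> pi / b * ln (norm (H 0))"
    using H_0 F(3) b by (intro mult_left_mono ln_mono) auto
  ultimately show "poisson_integrable b (cayley_log b F)"
    and "pi / b * ln (norm (F 0)) \<le> poisson_integral b (cayley_log b F)"
    by (simp_all add: has_bochner_integral_iff)
qed

lemma exists_zero_free_annulus:
  assumes F: "F holomorphic_on S" "open S" "connected S" and S: "cball 0 1 \<subseteq> S" and "F 0 \<noteq> 0"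
  obtains r where "0 \<le> r" "r < 1" "\<And>z. r < norm z \<Longrightarrow> norm z < 1 \<Longrightarrow> F z \<noteq> 0"
proof -
  define N where "N = insert 0 (norm ` {z\<in>cball 0 1. F z = 0} \<inter> {..<1})"
  have "finite {z\<in>cball 0 1. F z = 0}"
    by (rule holomorphic_finite_zeros_compact[OF F compact_cball S, of 0]) (use S assms(5) in auto)
  then have N: "finite N" "N \<noteq> {}"
    by (auto simp: N_def)
  show ?thesis
  proof (rule that[of "Max N"])
    show "0 \<le> Max N"
      using N by (intro Max_ge) (auto simp: N_def)
    show "Max N < 1"
      using N by (subst Max_less_iff) (auto simp: N_def)
    show "F z \<noteq> 0" if "Max N < norm z" "norm z < 1" for z
      using that N Max_ge[OF N(1), of "norm z"] by (auto simp: N_def)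
  qed
qed

lemma exists_zero_free_radii:
  assumes "F holomorphic_on S" "open S" "connected S" "cball 0 1 \<subseteq> S" "F 0 \<noteq> 0"
  obtains r :: "nat \<Rightarrow> real" where "\<And>n. 0 < r n" "\<And>n. r n < 1" "r \<longlonglongrightarrow> 1"
    "\<And>n z. norm z = r n \<Longrightarrow> F z \<noteq> 0"
proof -
  obtain r\<^sub>0 where r\<^sub>0: "0 \<le> r\<^sub>0" "r\<^sub>0 < 1" and nz: "\<And>z. r\<^sub>0 < norm z \<Longrightarrow> norm z < 1 \<Longrightarrow> F z \<noteq> 0"
    using exists_zero_free_annulus[OF assms] by metis
  define r where "r n = 1 - (1 - r\<^sub>0) / (real n + 2)" for n
  have r: "r\<^sub>0 < r n" "r n < 1" for n
  proof -
    have "(1 - r\<^sub>0) * 1 < (1 - r\<^sub>0) * (real n + 2)"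
      using r\<^sub>0 by (intro mult_strict_left_mono) auto
    then show "r\<^sub>0 < r n" "r n < 1"
      using r\<^sub>0 by (simp_all add: r_def field_simps)
  qed
  show ?thesis
  proof (rule that[of r])
    show "0 < r n" for n
      using r\<^sub>0(1) r(1)[of n] by simp
    show "r \<longlonglongrightarrow> 1"
      unfolding r_def by real_asymp
    show "F z \<noteq> 0" if "norm z = r n" for n z
      using that r[of n] by (intro nz) auto
  qed (rule r)
qed

lemma scale_in_cball:
  fixes z :: complex
  assumes "0 \<le> r" "r \<le> 1" "z \<in> cball 0 1"
  shows "of_real r * z \<in> cball 0 1"
  using assms mult_mono[of r 1 "norm z" 1] by (simp add: norm_mult)

lemma jensen_cayley_scaled:
  assumes F: "F analytic_on cball 0 1" "F 0 \<noteq> 0" and b: "b > 0"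
    and r: "0 < r" "r < 1" "\<And>z. norm z = r \<Longrightarrow> F z \<noteq> 0"
  shows "poisson_integrable b (cayley_log b (\<lambda>z. F (of_real r * z)))"
    and "pi / b * ln (norm (F 0)) \<le> poisson_integral b (cayley_log b (\<lambda>z. F (of_real r * z)))"
proof -
  have "(F \<circ> (\<lambda>z. of_real r * z)) analytic_on cball 0 1"
    using r scale_in_cball by (intro analytic_on_compose_gen[OF _ F(1)] analytic_intros) auto
  moreover have "(F \<circ> (\<lambda>z. of_real r * z)) z \<noteq> 0" if "norm z = 1" for z
    using that r by (simp add: norm_mult)
  moreover have "(F \<circ> (\<lambda>z. of_real r * z)) 0 \<noteq> 0"
    using F(2) by simp
  ultimately show "poisson_integrable b (cayley_log b (\<lambda>z. F (of_real r * z)))"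
    and "pi / b * ln (norm (F 0)) \<le> poisson_integral b (cayley_log b (\<lambda>z. F (of_real r * z)))"
    using jensen_cayley_nonzero_sphere[OF _ _ _ b, of "F \<circ> (\<lambda>z. of_real r * z)"] by simp_all
qed

lemma AE_cayley_log_scaled_tendsto:
  assumes F: "F holomorphic_on S" "open S" "connected S" "cball 0 1 \<subseteq> S" "F 0 \<noteq> 0"
    and b: "b > 0" and r: "r \<longlonglongrightarrow> 1"
  shows "AE t in lborel. (\<lambda>n. cayley_log b (\<lambda>z. F (of_real (r n) * z)) t) \<longlonglongrightarrow> cayley_log b F t"
proof -
  have cayley_mem: "cayley b (\<i> * of_real t) \<in> S" for t
    using F(4) norm_cayley_imaginary[OF b, of t] by (auto simp: subset_eq)
  have "AE t in lborel. F (cayley b (\<i> * of_real t)) \<noteq> 0"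
    by (rule AE_holomorphic_comp_inj_nonzero[OF F(1-3) _ F(5) _ inj_cayley_imaginary[OF b]])
      (use F(4) cayley_mem in auto)
  then show ?thesis
  proof eventually_elim
    case (elim t)
    let ?z = "cayley b (\<i> * of_real t)"
    have "isCont F ?z"
      using holomorphic_on_imp_continuous_on[OF F(1)] F(2) cayley_mem
      by (auto simp: continuous_on_eq_continuous_at)
    moreover have "(\<lambda>n. of_real (r n) * ?z) \<longlonglongrightarrow> ?z"
      using tendsto_mult[OF tendsto_of_real[OF r] tendsto_const[of ?z]] by simp
    ultimately have "(\<lambda>n. F (of_real (r n) * ?z)) \<longlonglongrightarrow> F ?z"
      by (rule isCont_tendsto_compose)
    then show ?case
      using elim by (intro tendsto_intros) auto
  qed
qed

text \<open>Zeros on the circle are avoided by passing to the circles of radius \<open>r < 1\<close>; only an inequality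
  survives the limit \<open>r \<rightarrow> 1\<close>, by Fatou's lemma.\<close>
lemma jensen_cayley:
  assumes F: "F analytic_on cball 0 1" "F 0 \<noteq> 0" and b: "b > 0"
  shows "poisson_integrable b (cayley_log b F)"
    and "pi / b * ln (norm (F 0)) \<le> poisson_integral b (cayley_log b F)"
proof -
  obtain S where S: "open S" "connected S" "cball 0 1 \<subseteq> S" and F_holo: "F holomorphic_on S"
    using analytic_on_connected_extend[OF F(1) connected_cball] by (metis centre_in_cball zero_le_one)
  have F_cont: "continuous_on (cball 0 1) F"
    using holomorphic_on_imp_continuous_on[OF F_holo] S(3) by (rule continuous_on_subset)
  obtain r where r: "\<And>n. 0 < r n" "\<And>n. r n < 1" and r_lim: "r \<longlonglongrightarrow> 1"
    and r_nz: "\<And>n z. norm z = r n \<Longrightarrow> F z \<noteq> 0"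
    using exists_zero_free_radii[OF F_holo S F(2)] by metis
  define u where "u n = cayley_log b (\<lambda>z. F (of_real (r n) * z))" for n
  have u_integrable: "poisson_integrable b (u n)"
      and u_ge: "pi / b * ln (norm (F 0)) \<le> poisson_integral b (u n)" for n
    unfolding u_def by (intro jensen_cayley_scaled F b r r_nz; assumption)+
  obtain M where M: "\<And>z. z \<in> cball 0 1 \<Longrightarrow> norm (F z) \<le> M"
    using continuous_on_compact_bound[OF compact_cball F_cont] by metis
  have "u n t \<le> log_bound (ln M) 0 t" for n t
  proof -
    have "norm (F (of_real (r n) * cayley b (\<i> * of_real t))) \<le> M"
      using r[of n] by (intro M scale_in_cball) (auto simp: norm_cayley_imaginary b less_imp_le)
    moreover have "F (of_real (r n) * cayley b (\<i> * of_real t)) \<noteq> 0"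
      using r(1)[of n] by (intro r_nz) (simp add: norm_mult norm_cayley_imaginary b)
    ultimately show ?thesis
      by (simp add: u_def ln_mono)
  qed
  then have u_le: "AE t in lborel. u n t / (b\<^sup>2 + t\<^sup>2) \<le> log_bound (ln M) 0 t / (b\<^sup>2 + t\<^sup>2)" for n
    by (intro AE_I2 divide_right_mono) auto
  have u_lim: "AE t in lborel. (\<lambda>n. u n t / (b\<^sup>2 + t\<^sup>2)) \<longlonglongrightarrow> cayley_log b F t / (b\<^sup>2 + t\<^sup>2)"
    using AE_cayley_log_scaled_tendsto[OF F_holo S F(2) b r_lim]
  proof eventually_elim
    case (elim t)
    then show ?case
      unfolding u_def using b by (intro tendsto_divide tendsto_const) (auto simp: add_nonneg_eq_0_iff)
  qed
  have measurable: "(\<lambda>t. cayley_log b F t / (b\<^sup>2 + t\<^sup>2)) \<in> borel_measurable lborel"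
    using borel_measurable_comp_cayley[OF F_cont sphere_cball b] by measurable
  show "poisson_integrable b (cayley_log b F)" "pi / b * ln (norm (F 0)) \<le> poisson_integral b (cayley_log b F)"
    by (rule reverse_fatou_integral[OF u_integrable poisson_integrable_log_bound[OF b] u_le measurable
        u_lim u_ge tendsto_const])+
qed

section \<open>Shrinking the right half-plane\<close>

definition shrink :: "real \<Rightarrow> complex \<Rightarrow> complex" where
  "shrink \<epsilon> w = (w + of_real \<epsilon>) / (1 + of_real \<epsilon> * w)"

lemma shrink_0 [simp]: "shrink 0 w = w"
  by (simp add: shrink_def)

lemma norm_shrink_denominator_imaginary:
  "1 \<le> norm (1 + of_real \<epsilon> * (\<i> * of_real t))"
  using complex_Re_le_cmod[of "1 + of_real \<epsilon> * (\<i> * of_real t)"] by simp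

lemma Re_shrink_imaginary_nonneg:
  assumes "0 \<le> \<epsilon>"
  shows "0 \<le> Re (shrink \<epsilon> (\<i> * of_real t))"
proof -
  have "0 \<le> \<epsilon> + \<epsilon> * t\<^sup>2"
    using assms by simp
  then show ?thesis
    unfolding shrink_def Re_complex_div_ge_0 by (simp add: power2_eq_square algebra_simps)
qed

lemma norm_shrink_imaginary_le:
  assumes "0 \<le> \<epsilon>" "\<epsilon> \<le> 1"
  shows "norm (shrink \<epsilon> (\<i> * of_real t)) \<le> 1 + \<bar>t\<bar>"
proof -
  have "norm (shrink \<epsilon> (\<i> * of_real t)) \<le> norm (\<i> * of_real t + of_real \<epsilon>) / 1"
    unfolding shrink_def norm_divide
    by (intro divide_left_mono norm_shrink_denominator_imaginary mult_pos_pos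
        less_le_trans[OF zero_less_one norm_shrink_denominator_imaginary]) auto
  also have "\<dots> \<le> 1 + \<bar>t\<bar>"
    using assms norm_triangle_ineq[of "\<i> * of_real t" "of_real \<epsilon>"] by (simp add: norm_mult)
  finally show ?thesis .
qed

lemma norm_shrink_imaginary_diff_ge:
  assumes \<epsilon>: "0 \<le> \<epsilon>" "\<epsilon> \<le> 1"
  shows "norm (\<i> * of_real t - \<i> * of_real y) / (1 + \<bar>t\<bar>) \<le> norm (shrink \<epsilon> (\<i> * of_real t) - \<i> * of_real y)"
proof -
  define d where "d = 1 + of_real \<epsilon> * (\<i> * of_real t)"
  have d_ge: "1 \<le> norm d"
    unfolding d_def by (rule norm_shrink_denominator_imaginary)
  have "norm d \<le> 1 + \<epsilon> * \<bar>t\<bar>"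
    using norm_triangle_ineq[of 1 "of_real \<epsilon> * (\<i> * of_real t)"] \<epsilon> by (simp add: d_def norm_mult)
  also have "\<dots> \<le> 1 + \<bar>t\<bar>"
    using \<epsilon> mult_right_mono[of \<epsilon> 1 "\<bar>t\<bar>"] by simp
  finally have d_le: "norm d \<le> 1 + \<bar>t\<bar>" .
  have "shrink \<epsilon> (\<i> * of_real t) - \<i> * of_real y = (\<i> * of_real t + of_real \<epsilon> - \<i> * of_real y * d) / d"
    using d_ge by (auto simp: shrink_def d_def[symmetric] divide_simps)
  also have "\<i> * of_real t + of_real \<epsilon> - \<i> * of_real y * d = Complex (\<epsilon> * (1 + t * y)) (t - y)"
    by (simp add: d_def complex_eq_iff algebra_simps)
  finally have "norm (shrink \<epsilon> (\<i> * of_real t) - \<i> * of_real y)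
      = norm (Complex (\<epsilon> * (1 + t * y)) (t - y)) / norm d"
    by (simp add: norm_divide)
  moreover have "\<bar>t - y\<bar> / (1 + \<bar>t\<bar>) \<le> norm (Complex (\<epsilon> * (1 + t * y)) (t - y)) / norm d"
    using abs_Im_le_cmod[of "Complex (\<epsilon> * (1 + t * y)) (t - y)"] d_ge d_le by (intro frac_le) auto
  moreover have "norm (\<i> * of_real t - \<i> * of_real y) = \<bar>t - y\<bar>"
    by (simp add: cmod_def)
  ultimately show ?thesis by simp
qed

lemma tendsto_shrink:
  assumes "e \<longlonglongrightarrow> 0"
  shows "(\<lambda>n. shrink (e n) w) \<longlonglongrightarrow> w"
proof -
  have "(\<lambda>n. shrink (e n) w) \<longlonglongrightarrow> shrink 0 w"
    unfolding shrink_def by (intro tendsto_intros assms) auto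
  then show ?thesis by simp
qed

text \<open>The map \<open>shrink \<epsilon>\<close> in the coordinate \<open>z = cayley b w\<close>, where it is also analytic at \<open>w = \<infinity>\<close>.\<close>
definition shrink_disc :: "real \<Rightarrow> real \<Rightarrow> complex \<Rightarrow> complex" where
  "shrink_disc b \<epsilon> z = (of_real b * (1 + z) + of_real \<epsilon> * (1 - z)) / ((1 - z) + of_real (\<epsilon> * b) * (1 + z))"

lemma shrink_disc_cayley:
  assumes b: "b > 0" and w: "0 \<le> Re w"
  shows "shrink_disc b \<epsilon> (cayley b w) = shrink \<epsilon> w"
proof -
  have nz: "w + of_real b \<noteq> 0"
    using assms by (auto simp: complex_eq_iff)
  have one_plus_cayley: "1 + cayley b w = 2 * w / (w + of_real b)"
    and one_minus_cayley: "1 - cayley b w = 2 * of_real b / (w + of_real b)"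
    using nz by (simp_all add: cayley_def field_simps)
  have "shrink_disc b \<epsilon> (cayley b w) =
      (2 * of_real b * (w + of_real \<epsilon>) / (w + of_real b))
          / (2 * of_real b * (1 + of_real \<epsilon> * w) / (w + of_real b))"
    unfolding shrink_disc_def one_plus_cayley one_minus_cayley
    by (simp add: algebra_simps flip: add_divide_distrib)
  also have "\<dots> = shrink \<epsilon> w"
    using nz b by (simp add: shrink_def)
  finally show ?thesis .
qed

lemma Re_shrink_disc_pos:
  assumes b: "b > 0" and \<epsilon>: "\<epsilon> > 0" and z: "z \<in> cball 0 1"
  shows "0 < Re (shrink_disc b \<epsilon> z)"
proof -
  have "(Re z)\<^sup>2 + (Im z)\<^sup>2 \<le> 1"
    using z power_mono[of "norm z" 1 2] by (simp add: cmod_power2)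
  then have "0 \<le> Re ((1 + z) * cnj (1 - z))"
    by (simp add: power2_eq_square algebra_simps)
  moreover have "0 < b\<^sup>2 * (norm (1 + z))\<^sup>2 + (norm (1 - z))\<^sup>2"
  proof (cases "z = 1")
    case False
    then show ?thesis using b by (intro add_nonneg_pos) auto
  qed (use b in simp)
  ultimately have "0 < b * (1 + \<epsilon>\<^sup>2) * Re ((1 + z) * cnj (1 - z))
      + \<epsilon> * (b\<^sup>2 * (norm (1 + z))\<^sup>2 + (norm (1 - z))\<^sup>2)"
    using b \<epsilon> by (intro add_nonneg_pos[OF mult_nonneg_nonneg mult_pos_pos]) auto
  then show ?thesis
    unfolding shrink_disc_def Re_complex_div_gt_0 cmod_power2
    by (simp add: power2_eq_square algebra_simps)
qed

lemma analytic_on_shrink_disc: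
  assumes "b > 0" "\<epsilon> > 0"
  shows "shrink_disc b \<epsilon> analytic_on cball 0 1"
proof -
  have "(1 - z) + of_real (\<epsilon> * b) * (1 + z) \<noteq> 0" if "z \<in> cball 0 1" for z :: complex
    using Re_shrink_disc_pos[OF assms that] unfolding shrink_disc_def by auto
  then show ?thesis
    unfolding shrink_disc_def by (intro analytic_intros) auto
qed

lemma prod_norm_shrink_imaginary_ge:
  assumes \<epsilon>: "0 \<le> \<epsilon>" "\<epsilon> \<le> 1" and t: "\<bar>t\<bar> \<le> X" and Z: "\<And>w. w \<in> Z \<Longrightarrow> Re w = 0"
  shows "(\<Prod>w\<in>Z. norm (\<i> * of_real t - w) ^ n w)
    \<le> (1 + X) ^ (\<Sum>w\<in>Z. n w) * (\<Prod>w\<in>Z. norm (shrink \<epsilon> (\<i> * of_real t) - w) ^ n w)"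
proof -
  have factor: "norm (\<i> * of_real t - w) \<le> (1 + X) * norm (shrink \<epsilon> (\<i> * of_real t) - w)" if "w \<in> Z" for w
  proof -
    have "w = \<i> * of_real (Im w)"
      using Z[OF that] by (simp add: complex_eq_iff)
    then have "norm (\<i> * of_real t - w) / (1 + \<bar>t\<bar>) \<le> norm (shrink \<epsilon> (\<i> * of_real t) - w)"
      using norm_shrink_imaginary_diff_ge[OF \<epsilon>, of t "Im w"] by simp
    then have "norm (\<i> * of_real t - w) \<le> (1 + \<bar>t\<bar>) * norm (shrink \<epsilon> (\<i> * of_real t) - w)"
      by (simp add: pos_divide_le_eq mult.commute)
    also have "\<dots> \<le> (1 + X) * norm (shrink \<epsilon> (\<i> * of_real t) - w)"
      using t by (intro mult_right_mono) auto
    finally show ?thesis .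
  qed
  have "(\<Prod>w\<in>Z. norm (\<i> * of_real t - w) ^ n w) \<le> (\<Prod>w\<in>Z. ((1 + X) * norm (shrink \<epsilon> (\<i> * of_real t) - w)) ^ n w)"
    by (intro prod_mono conjI power_mono factor) auto
  then show ?thesis
    by (simp add: power_mult_distrib prod.distrib power_sum)
qed

section \<open>Jensen's inequality on the right half-plane\<close>

definition polynomially_bounded_on :: "(complex \<Rightarrow> complex) \<Rightarrow> complex set \<Rightarrow> bool" where
  "polynomially_bounded_on G S \<longleftrightarrow> (\<exists>C K. \<forall>s\<in>S. norm (G s) \<le> C * (1 + norm s) ^ K)"

lemma polynomially_bounded_onE:
  assumes "polynomially_bounded_on G S"
  obtains C K where "1 \<le> C" "\<And>s. s \<in> S \<Longrightarrow> norm (G s) \<le> C * (1 + norm s) ^ K"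
proof -
  obtain C K where CK: "\<And>s. s \<in> S \<Longrightarrow> norm (G s) \<le> C * (1 + norm s) ^ K"
    using assms unfolding polynomially_bounded_on_def by blast
  have "C * (1 + norm s) ^ K \<le> max C 1 * (1 + norm s) ^ K" for s
    by (intro mult_right_mono) auto
  then show ?thesis
    using CK by (intro that[of "max C 1" K]) (auto intro: order_trans)
qed

lemma polynomially_bounded_on_subset:
  "polynomially_bounded_on f S \<Longrightarrow> T \<subseteq> S \<Longrightarrow> polynomially_bounded_on f T"
  unfolding polynomially_bounded_on_def by blast

lemma polynomially_bounded_on_translate:
  assumes "polynomially_bounded_on f ((\<lambda>s. c + s) ` S)"
  shows "polynomially_bounded_on (\<lambda>s. f (c + s)) S"
proof -
  obtain C K where C: "1 \<le> C" and bound: "\<And>s. s \<in> (\<lambda>s. c + s) ` S \<Longrightarrow> norm (f s) \<le> C * (1 + norm s) ^ K"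
    by (rule polynomially_bounded_onE[OF assms]) (rule that)
  have "norm (f (c + s)) \<le> C * (1 + norm c) ^ K * (1 + norm s) ^ K" if "s \<in> S" for s
  proof -
    have "1 + norm (c + s) \<le> (1 + norm c) * (1 + norm s)"
      using norm_triangle_ineq[of c s] mult_nonneg_nonneg[OF norm_ge_zero[of c] norm_ge_zero[of s]]
      unfolding distrib_left distrib_right by linarith
    then have "C * (1 + norm (c + s)) ^ K \<le> C * ((1 + norm c) * (1 + norm s)) ^ K"
      using C by (intro mult_left_mono power_mono) auto
    then show ?thesis
      using bound[of "c + s"] that by (simp add: power_mult_distrib mult.assoc)
  qed
  then show ?thesis
    unfolding polynomially_bounded_on_def by blast
qed

locale half_plane_function =
  fixes G :: "complex \<Rightarrow> complex" and a :: real
  assumes a_neg: "a < 0" and holomorphic: "G holomorphic_on {s. Re s > a}"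
    and polynomially_bounded: "polynomially_bounded_on G {s. Re s \<ge> 0}"
begin

definition log_trace :: "real \<Rightarrow> real \<Rightarrow> real" where
  "log_trace \<epsilon> t = ln (norm (G (shrink \<epsilon> (\<i> * of_real t))))"

lemma isCont_G: "Re s > a \<Longrightarrow> isCont G s"
  using holomorphic_on_imp_continuous_on[OF holomorphic]
  by (auto simp: continuous_on_eq_continuous_at open_Re_gt)

lemma borel_measurable_log_trace_0: "log_trace 0 \<in> borel_measurable borel"
proof -
  have "continuous_on UNIV (\<lambda>t. G (\<i> * of_real t))"
    using a_neg by (intro continuous_on_compose2[OF holomorphic_on_imp_continuous_on[OF holomorphic]]
        continuous_intros) auto
  from borel_measurable_continuous_onI[OF this] show ?thesis
    unfolding log_trace_def shrink_0 by measurable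
qed

lemma log_trace_le:
  obtains A B where "0 \<le> A" "0 \<le> B"
    "\<And>\<epsilon> t. 0 \<le> \<epsilon> \<Longrightarrow> \<epsilon> \<le> 1 \<Longrightarrow> log_trace \<epsilon> t \<le> log_bound A B t"
proof -
  obtain C K where C: "1 \<le> C" and bound: "\<And>s. s \<in> {s. Re s \<ge> 0} \<Longrightarrow> norm (G s) \<le> C * (1 + norm s) ^ K"
    by (rule polynomially_bounded_onE[OF polynomially_bounded]) (rule that)
  have "log_trace \<epsilon> t \<le> ln C + real K * ln (2 + \<bar>t\<bar>)" if \<epsilon>: "0 \<le> \<epsilon>" "\<epsilon> \<le> 1" for \<epsilon> t
  proof (cases "G (shrink \<epsilon> (\<i> * of_real t)) = 0")
    case True
    then show ?thesis using C by (simp add: log_trace_def)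
  next
    case False
    have "norm (G (shrink \<epsilon> (\<i> * of_real t))) \<le> C * (1 + norm (shrink \<epsilon> (\<i> * of_real t))) ^ K"
      by (intro bound CollectI Re_shrink_imaginary_nonneg \<epsilon>)
    also have "\<dots> \<le> C * (2 + \<bar>t\<bar>) ^ K"
      using C norm_shrink_imaginary_le[OF \<epsilon>, of t] by (intro mult_left_mono power_mono) auto
    finally have "log_trace \<epsilon> t \<le> ln (C * (2 + \<bar>t\<bar>) ^ K)"
      unfolding log_trace_def using False by (intro ln_mono) auto
    also have "\<dots> = ln C + real K * ln (2 + \<bar>t\<bar>)"
      using C by (subst ln_mult) (auto simp: ln_realpow)
    finally show ?thesis .
  qed
  then show ?thesis
    using C by (intro that[of "ln C" "real K"]) auto
qed

lemma log_trace_tendsto: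
  assumes "e \<longlonglongrightarrow> 0" "G (\<i> * of_real t) \<noteq> 0"
  shows "(\<lambda>n. log_trace (e n) t) \<longlonglongrightarrow> log_trace 0 t"
  using assms a_neg unfolding log_trace_def shrink_0
  by (intro tendsto_intros isCont_tendsto_compose[OF isCont_G] tendsto_shrink) auto

lemma AE_imaginary_axis_nonzero:
  assumes "Re z > a" "G z \<noteq> 0"
  shows "AE t in (lborel :: real measure). G (\<i> * of_real t) \<noteq> 0"
  using assms a_neg
  by (intro AE_holomorphic_comp_inj_nonzero[OF holomorphic open_Re_gt connected_Re_gt]) (auto intro: injI)

lemma AE_log_trace_tendsto:
  assumes e: "e \<longlonglongrightarrow> 0" and z: "Re z > a" "G z \<noteq> 0" and b: "b > 0"
  shows "AE t in lborel. (\<lambda>n. log_trace (e n) t / (b\<^sup>2 + t\<^sup>2)) \<longlonglongrightarrow> log_trace 0 t / (b\<^sup>2 + t\<^sup>2)"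
  using AE_imaginary_axis_nonzero[OF z]
proof eventually_elim
  case (elim t)
  show ?case
    using b by (intro tendsto_intros log_trace_tendsto e elim) (auto simp: add_nonneg_eq_0_iff)
qed

lemma analytic_on_comp_shrink_disc:
  assumes "b > 0" "\<epsilon> > 0"
  shows "(G \<circ> shrink_disc b \<epsilon>) analytic_on cball 0 1"
proof (rule analytic_on_compose_gen)
  show "G analytic_on {s. Re s > a}"
    using holomorphic by (simp add: analytic_on_open open_Re_gt)
  show "shrink_disc b \<epsilon> z \<in> {s. Re s > a}" if "z \<in> cball 0 1" for z
    using Re_shrink_disc_pos[OF assms that] a_neg by simp
qed (rule analytic_on_shrink_disc[OF assms])

lemma ln_norm_comp_shrink_disc_cayley:
  assumes "b > 0"
  shows "ln (norm ((G \<circ> shrink_disc b \<epsilon>) (cayley b (\<i> * of_real t)))) = log_trace \<epsilon> t"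
  using assms by (simp add: log_trace_def shrink_disc_cayley)

lemma comp_shrink_disc_0:
  assumes "b > 0"
  shows "(G \<circ> shrink_disc b \<epsilon>) 0 = G (shrink \<epsilon> (of_real b))"
  using shrink_disc_cayley[OF assms, of "of_real b"] assms by (simp add: cayley_def)

lemma jensen_log_trace:
  assumes b: "b > 0" and "\<epsilon> > 0" and "G (shrink \<epsilon> (of_real b)) \<noteq> 0"
  shows "poisson_integrable b (log_trace \<epsilon>)"
    and "pi / b * ln (norm (G (shrink \<epsilon> (of_real b)))) \<le> poisson_integral b (log_trace \<epsilon>)"
  using jensen_cayley[OF analytic_on_comp_shrink_disc[OF assms(1,2)] _ b] assms
  unfolding comp_shrink_disc_0[OF b] ln_norm_comp_shrink_disc_cayley[OF b] by blast+

lemma log_trace_mean_value: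
  assumes b: "b > 0" and \<epsilon>: "\<epsilon> > 0" and nz: "\<And>s. Re s > 0 \<Longrightarrow> G s \<noteq> 0"
  shows "has_poisson_integral b (log_trace \<epsilon>) (pi / b * ln (norm (G (shrink \<epsilon> (of_real b)))))"
proof -
  have "(G \<circ> shrink_disc b \<epsilon>) z \<noteq> 0" if "z \<in> cball 0 1" for z
    using nz Re_shrink_disc_pos[OF b \<epsilon> that] by simp
  from ln_norm_mean_value_cayley[OF analytic_imp_holomorphic[OF analytic_on_comp_shrink_disc[OF b \<epsilon>]] this b]
  show ?thesis
    unfolding comp_shrink_disc_0[OF b] ln_norm_comp_shrink_disc_cayley[OF b] .
qed

lemma ln_norm_shrink_tendsto:
  assumes "e \<longlonglongrightarrow> 0" "b > 0" "G (of_real b) \<noteq> 0"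
  shows "(\<lambda>n. pi / b * ln (norm (G (shrink (e n) (of_real b))))) \<longlonglongrightarrow> pi / b * ln (norm (G (of_real b)))"
  using assms a_neg
  by (intro tendsto_intros isCont_tendsto_compose[OF isCont_G] tendsto_shrink) auto

lemma exists_shrink_sequence:
  assumes "b > 0" "G (of_real b) \<noteq> 0"
  obtains e :: "nat \<Rightarrow> real" where "\<And>n. 0 < e n" "\<And>n. e n \<le> 1" "e \<longlonglongrightarrow> 0" "\<And>n. G (shrink (e n) (of_real b)) \<noteq> 0"
proof -
  let ?e = "\<lambda>n. inverse (real (Suc n))"
  have "(\<lambda>n. G (shrink (?e n) (of_real b))) \<longlonglongrightarrow> G (of_real b)"
    using assms(1) a_neg
    by (intro isCont_tendsto_compose[OF isCont_G] tendsto_shrink LIMSEQ_inverse_real_of_nat) auto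
  then have "\<forall>\<^sub>F n in sequentially. G (shrink (?e n) (of_real b)) \<noteq> 0"
    using assms(2) by (rule tendsto_imp_eventually_ne)
  then obtain N where "\<And>n. n \<ge> N \<Longrightarrow> G (shrink (?e n) (of_real b)) \<noteq> 0"
    by (auto simp: eventually_sequentially)
  then show ?thesis
    by (intro that[of "\<lambda>n. ?e (n + N)"] LIMSEQ_ignore_initial_segment[OF LIMSEQ_inverse_real_of_nat])
      (auto simp: field_simps simp del: of_nat_add)
qed

theorem jensen_half_plane:
  assumes b: "b > 0" and nz: "G (of_real b) \<noteq> 0"
  shows "poisson_integrable b (log_trace 0)"
    and "pi / b * ln (norm (G (of_real b))) \<le> poisson_integral b (log_trace 0)"
proof -
  obtain e :: "nat \<Rightarrow> real" where e: "\<And>n. 0 < e n" "\<And>n. e n \<le> 1" "e \<longlonglongrightarrow> 0"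
    and e_nz: "\<And>n. G (shrink (e n) (of_real b)) \<noteq> 0"
    using exists_shrink_sequence[OF b nz] by metis
  obtain A B where log_bound: "\<And>\<epsilon> t. 0 \<le> \<epsilon> \<Longrightarrow> \<epsilon> \<le> 1 \<Longrightarrow> log_trace \<epsilon> t \<le> log_bound A B t"
    using log_trace_le by metis
  have trace_le: "AE t in lborel. log_trace (e n) t / (b\<^sup>2 + t\<^sup>2) \<le> log_bound A B t / (b\<^sup>2 + t\<^sup>2)" for n
    using e less_imp_le by (intro AE_I2 divide_right_mono log_bound) auto
  have measurable: "(\<lambda>t. log_trace 0 t / (b\<^sup>2 + t\<^sup>2)) \<in> borel_measurable lborel"
    using borel_measurable_log_trace_0 by measurable
  have trace_lim: "AE t in lborel. (\<lambda>n. log_trace (e n) t / (b\<^sup>2 + t\<^sup>2)) \<longlonglongrightarrow> log_trace 0 t / (b\<^sup>2 + t\<^sup>2)"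
    by (rule AE_log_trace_tendsto[OF e(3) _ nz b]) (use a_neg b in simp)
  show "poisson_integrable b (log_trace 0)"
    and "pi / b * ln (norm (G (of_real b))) \<le> poisson_integral b (log_trace 0)"
    by (rule reverse_fatou_integral[OF jensen_log_trace(1)[OF b e(1) e_nz] poisson_integrable_log_bound[OF b]
        trace_le measurable trace_lim jensen_log_trace(2)[OF b e(1) e_nz] ln_norm_shrink_tendsto[OF e(3) b nz]])+
qed

text \<open>Zeros on the axis are the only obstacle; after dividing out the finitely many of them in a compact
  set, the rest of \<open>G\<close> is bounded above and away from \<open>0\<close> there.\<close>
lemma norm_shrink_ge:
  assumes nz: "\<And>s. Re s > 0 \<Longrightarrow> G s \<noteq> 0" and X: "0 \<le> X"
  obtains c where "0 < c" "\<And>\<epsilon> t. 0 \<le> \<epsilon> \<Longrightarrow> \<epsilon> \<le> 1 \<Longrightarrow> \<bar>t\<bar> \<le> X \<Longrightarrow>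
    c * norm (G (\<i> * of_real t)) \<le> norm (G (shrink \<epsilon> (\<i> * of_real t)))"
proof -
  define K where "K = {s. Re s \<ge> 0} \<inter> cball 0 (1 + X)"
  have K: "compact K" "K \<subseteq> {s. Re s > a}"
    using a_neg by (auto simp: K_def intro: closed_Int_compact closed_halfspace_Re_ge)
  have G_1: "1 \<in> {s. Re s > a}" "G 1 \<noteq> 0"
    using nz[of 1] a_neg by simp_all
  obtain Z n C where Z: "Z \<subseteq> {s\<in>K. G s = 0}" and C: "C > 0"
    and norm_G_le: "\<And>s. s \<in> K \<Longrightarrow> norm (G s) \<le> C * (\<Prod>w\<in>Z. norm (s - w) ^ n w)"
    and norm_G_ge: "\<And>s. s \<in> K \<Longrightarrow> (\<Prod>w\<in>Z. norm (s - w) ^ n w) \<le> C * norm (G s)"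
    by (rule holomorphic_comparable_zero_product[OF holomorphic open_Re_gt connected_Re_gt K G_1]) (rule that)
  have Z_imaginary: "Re w = 0" if "w \<in> Z" for w
    using that Z nz[of w] by (force simp: K_def)
  define D where "D = C * (1 + X) ^ (\<Sum>w\<in>Z. n w) * C"
  have "norm (G (\<i> * of_real t)) \<le> D * norm (G (shrink \<epsilon> (\<i> * of_real t)))"
    if \<epsilon>: "0 \<le> \<epsilon>" "\<epsilon> \<le> 1" and t: "\<bar>t\<bar> \<le> X" for \<epsilon> t
  proof -
    define s s' where "s = \<i> * complex_of_real t" and "s' = shrink \<epsilon> s"
    have mem: "s \<in> K" "s' \<in> K"
      using t X norm_shrink_imaginary_le[OF \<epsilon>, of t] Re_shrink_imaginary_nonneg[OF \<epsilon>(1), of t]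
      by (auto simp: K_def s_def s'_def norm_mult)
    note norm_G_le[OF mem(1)]
    also have "(\<Prod>w\<in>Z. norm (s - w) ^ n w) \<le> (1 + X) ^ (\<Sum>w\<in>Z. n w) * (\<Prod>w\<in>Z. norm (s' - w) ^ n w)"
      unfolding s_def s'_def by (intro prod_norm_shrink_imaginary_ge \<epsilon> t Z_imaginary)
    also note norm_G_ge[OF mem(2)]
    finally show ?thesis
      using C X by (simp add: D_def s_def s'_def mult.assoc)
  qed
  moreover have "D > 0"
    unfolding D_def using C X by (intro mult_pos_pos zero_less_power) auto
  ultimately show ?thesis
    by (intro that[of "1 / D"]) (simp_all add: pos_divide_le_eq mult.commute)
qed

lemma abs_log_trace_le:
  assumes "\<And>s. Re s > 0 \<Longrightarrow> G s \<noteq> 0" and "0 \<le> X"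
  obtains A B where "\<And>\<epsilon> t. 0 \<le> \<epsilon> \<Longrightarrow> \<epsilon> \<le> 1 \<Longrightarrow> \<bar>t\<bar> \<le> X \<Longrightarrow> G (\<i> * of_real t) \<noteq> 0 \<Longrightarrow>
    \<bar>log_trace \<epsilon> t\<bar> \<le> \<bar>log_trace 0 t\<bar> + log_bound A B t"
proof -
  obtain c where c: "0 < c" and norm_ge: "\<And>\<epsilon> t. 0 \<le> \<epsilon> \<Longrightarrow> \<epsilon> \<le> 1 \<Longrightarrow> \<bar>t\<bar> \<le> X \<Longrightarrow>
      c * norm (G (\<i> * of_real t)) \<le> norm (G (shrink \<epsilon> (\<i> * of_real t)))"
    using norm_shrink_ge[OF assms] by metis
  obtain A B where AB: "0 \<le> A" "0 \<le> B"
    and trace_le: "\<And>\<epsilon> t. 0 \<le> \<epsilon> \<Longrightarrow> \<epsilon> \<le> 1 \<Longrightarrow> log_trace \<epsilon> t \<le> log_bound A B t"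
    using log_trace_le by metis
  have "\<bar>log_trace \<epsilon> t\<bar> \<le> \<bar>log_trace 0 t\<bar> + log_bound (\<bar>ln c\<bar> + A) B t"
    if \<epsilon>: "0 \<le> \<epsilon>" "\<epsilon> \<le> 1" and "\<bar>t\<bar> \<le> X" "G (\<i> * of_real t) \<noteq> 0" for \<epsilon> t
  proof -
    have "ln (c * norm (G (\<i> * of_real t))) \<le> log_trace \<epsilon> t"
      unfolding log_trace_def using c that by (intro ln_mono norm_ge) auto
    then have "ln c + log_trace 0 t \<le> log_trace \<epsilon> t"
      using c that by (simp add: log_trace_def ln_mult)
    moreover have "0 \<le> B * ln (2 + \<bar>t\<bar>)"
      using AB by simp
    ultimately show ?thesis
      using trace_le[OF \<epsilon>, of t] AB by linarith
  qed
  then show ?thesis by (rule that)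
qed

lemma integral_log_trace_compact_tendsto:
  assumes nz: "\<And>s. Re s > 0 \<Longrightarrow> G s \<noteq> 0" and b: "b > 0" and X: "0 \<le> X"
    and e: "\<And>n. 0 < e n" "\<And>n. e n \<le> 1" "e \<longlonglongrightarrow> 0"
  shows "(\<lambda>n. LBINT t:{-X..X}. log_trace (e n) t / (b\<^sup>2 + t\<^sup>2))
      \<longlonglongrightarrow> (LBINT t:{-X..X}. log_trace 0 t / (b\<^sup>2 + t\<^sup>2))"
proof -
  obtain A B where abs_trace_le: "\<And>\<epsilon> t. 0 \<le> \<epsilon> \<Longrightarrow> \<epsilon> \<le> 1 \<Longrightarrow> \<bar>t\<bar> \<le> X \<Longrightarrow> G (\<i> * of_real t) \<noteq> 0 \<Longrightarrow>
      \<bar>log_trace \<epsilon> t\<bar> \<le> \<bar>log_trace 0 t\<bar> + log_bound A B t"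
    using abs_log_trace_le[OF nz X] by metis
  have G_nz: "AE t in lborel. G (\<i> * of_real t) \<noteq> 0"
    using AE_imaginary_axis_nonzero[of 1] nz[of 1] a_neg by simp
  have G_b: "G (of_real b) \<noteq> 0"
    using nz[of "of_real b"] b by simp
  have trace_lim: "AE t in lborel. (\<lambda>n. log_trace (e n) t / (b\<^sup>2 + t\<^sup>2)) \<longlonglongrightarrow> log_trace 0 t / (b\<^sup>2 + t\<^sup>2)"
    by (rule AE_log_trace_tendsto[OF e(3) _ G_b b]) (use a_neg b in simp)
  show ?thesis
    unfolding set_lebesgue_integral_def
  proof (rule integral_dominated_convergence)
    show "integrable lborel (\<lambda>t. \<bar>log_trace 0 t / (b\<^sup>2 + t\<^sup>2)\<bar> + \<bar>log_bound A B t / (b\<^sup>2 + t\<^sup>2)\<bar>)"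
      by (intro Bochner_Integration.integrable_add integrable_abs poisson_integrable_log_bound
          b jensen_half_plane(1) G_b)
    show "(\<lambda>t. indicat_real {-X..X} t *\<^sub>R (log_trace 0 t / (b\<^sup>2 + t\<^sup>2))) \<in> borel_measurable lborel"
      using borel_measurable_log_trace_0 by measurable
    show "(\<lambda>t. indicat_real {-X..X} t *\<^sub>R (log_trace (e n) t / (b\<^sup>2 + t\<^sup>2))) \<in> borel_measurable lborel" for n
      using has_bochner_integral_iff[THEN iffD1, OF log_trace_mean_value[OF b e(1)[of n] nz]]
      by (intro borel_measurable_scaleR) auto
    show "AE t in lborel. (\<lambda>n. indicat_real {-X..X} t *\<^sub>R (log_trace (e n) t / (b\<^sup>2 + t\<^sup>2)))
        \<longlonglongrightarrow> indicat_real {-X..X} t *\<^sub>R (log_trace 0 t / (b\<^sup>2 + t\<^sup>2))"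
      using trace_lim by eventually_elim (rule tendsto_scaleR[OF tendsto_const])
    show "AE t in lborel. norm (indicat_real {-X..X} t *\<^sub>R (log_trace (e n) t / (b\<^sup>2 + t\<^sup>2)))
        \<le> \<bar>log_trace 0 t / (b\<^sup>2 + t\<^sup>2)\<bar> + \<bar>log_bound A B t / (b\<^sup>2 + t\<^sup>2)\<bar>" for n
      using G_nz
    proof eventually_elim
      case (elim t)
      have "\<bar>log_trace (e n) t\<bar> \<le> \<bar>log_trace 0 t\<bar> + \<bar>log_bound A B t\<bar>" if "\<bar>t\<bar> \<le> X"
        using abs_trace_le[OF less_imp_le[OF e(1)] e(2) that elim, of n] by linarith
      then have "\<bar>log_trace (e n) t\<bar> / \<bar>b\<^sup>2 + t\<^sup>2\<bar> \<le> \<bar>log_trace 0 t\<bar> / \<bar>b\<^sup>2 + t\<^sup>2\<bar>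
          + \<bar>log_bound A B t\<bar> / \<bar>b\<^sup>2 + t\<^sup>2\<bar>"
        if "\<bar>t\<bar> \<le> X"
        using that by (simp add: divide_right_mono flip: add_divide_distrib)
      then show ?case
        by (auto simp: indicator_def abs_divide)
    qed
  qed
qed

text \<open>For \<open>|t| > X\<close> the kernels centred at \<open>b\<close> and at \<open>X\<close> are comparable, so the mass of \<^const>\<open>log_trace\<close>
  outside \<open>[-X, X]\<close> is controlled by the mean value property at \<open>X\<close>.\<close>
lemma compact_poisson_integral_defect_le:
  assumes nz: "\<And>s. Re s > 0 \<Longrightarrow> G s \<noteq> 0" and b: "b > 0" and X: "X > 0" and AB: "0 \<le> A" "0 \<le> B"
    and trace_le: "\<And>\<epsilon> t. 0 \<le> \<epsilon> \<Longrightarrow> \<epsilon> \<le> 1 \<Longrightarrow> log_trace \<epsilon> t \<le> log_bound A B t"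
  shows "\<bar>pi / b * ln (norm (G (of_real b))) - (LBINT t:{-X..X}. log_trace 0 t / (b\<^sup>2 + t\<^sup>2))\<bar>
    \<le> 4 * poisson_integral X (log_bound A B) - 2 * (pi / X * ln (norm (G (of_real X))))"
proof -
  have G_nz: "G (of_real x) \<noteq> 0" if "0 < x" for x
    using nz[of "of_real x"] that by simp
  obtain e :: "nat \<Rightarrow> real" where e: "\<And>n. 0 < e n" "\<And>n. e n \<le> 1" and e_lim: "e \<longlonglongrightarrow> 0"
    using exists_shrink_sequence[OF b G_nz[OF b]] by metis
  note mean_value = log_trace_mean_value[OF _ e(1) nz, THEN has_bochner_integral_iff[THEN iffD1]]
  define I where "I n = poisson_integral b (log_trace (e n))" for n
  define J where "J \<epsilon> = (LBINT t:{-X..X}. log_trace \<epsilon> t / (b\<^sup>2 + t\<^sup>2))" for \<epsilon>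
  have tail: "\<bar>I n - J (e n)\<bar>
      \<le> 4 * poisson_integral X (log_bound A B) - 2 * (pi / X * ln (norm (G (shrink (e n) (of_real X)))))" for n
  proof -
    have "\<bar>I n - J (e n)\<bar> \<le> 4 * poisson_integral X (log_bound A B) - 2 * poisson_integral X (log_trace (e n))"
      unfolding I_def J_def
      by (rule poisson_integral_tail_le[OF X trace_le _ _ _ poisson_integrable_log_bound[OF X]])
        (use e mean_value b X AB in \<open>auto intro: less_imp_le\<close>)
    then show ?thesis
      using mean_value[OF X] by simp
  qed
  have "I \<longlonglongrightarrow> pi / b * ln (norm (G (of_real b)))"
    using ln_norm_shrink_tendsto[OF e_lim b G_nz[OF b]] mean_value[OF b] by (simp add: I_def[abs_def])
  moreover have "(\<lambda>n. J (e n)) \<longlonglongrightarrow> J 0"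
    unfolding J_def by (rule integral_log_trace_compact_tendsto[OF nz b less_imp_le[OF X] e e_lim])
  ultimately have "(\<lambda>n. \<bar>I n - J (e n)\<bar>) \<longlonglongrightarrow> \<bar>pi / b * ln (norm (G (of_real b))) - J 0\<bar>"
    by (intro tendsto_intros)
  then show ?thesis
    using tendsto_diff[OF tendsto_const tendsto_mult
        [OF tendsto_const ln_norm_shrink_tendsto[OF e_lim X G_nz[OF X]]]]
    unfolding J_def by (rule LIMSEQ_le) (use tail in \<open>unfold J_def, blast\<close>)
qed

lemma poisson_integral_defect_le:
  assumes nz: "\<And>s. Re s > 0 \<Longrightarrow> G s \<noteq> 0" and b: "b > 0"
  obtains A B where "\<And>X. 0 < X \<Longrightarrow>
    \<bar>pi / b * ln (norm (G (of_real b))) - poisson_integral b (log_trace 0)\<bar>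
      \<le> 8 * poisson_integral X (log_bound A B) - 4 * (pi / X * ln (norm (G (of_real X))))"
proof -
  obtain A B where AB: "0 \<le> A" "0 \<le> B"
    and trace_le: "\<And>\<epsilon> t. 0 \<le> \<epsilon> \<Longrightarrow> \<epsilon> \<le> 1 \<Longrightarrow> log_trace \<epsilon> t \<le> log_bound A B t"
    using log_trace_le by metis
  have G_nz: "G (of_real x) \<noteq> 0" if "0 < x" for x
    using nz[of "of_real x"] that by simp
  show ?thesis
  proof (rule that)
    fix X :: real
    assume X: "0 < X"
    let ?H = "poisson_integral X (log_bound A B)"
    have "\<bar>pi / b * ln (norm (G (of_real b))) - (LBINT t:{-X..X}. log_trace 0 t / (b\<^sup>2 + t\<^sup>2))\<bar>
        \<le> 4 * ?H - 2 * (pi / X * ln (norm (G (of_real X))))"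
      by (rule compact_poisson_integral_defect_le[OF nz b X AB trace_le])
    moreover have "\<bar>poisson_integral b (log_trace 0) - (LBINT t:{-X..X}. log_trace 0 t / (b\<^sup>2 + t\<^sup>2))\<bar>
        \<le> 4 * ?H - 2 * poisson_integral X (log_trace 0)"
      using AB by (intro poisson_integral_tail_le X b trace_le poisson_integrable_log_bound
          jensen_half_plane(1) G_nz) auto
    moreover have "pi / X * ln (norm (G (of_real X))) \<le> poisson_integral X (log_trace 0)"
      by (rule jensen_half_plane(2)[OF X G_nz[OF X]])
    ultimately show "\<bar>pi / b * ln (norm (G (of_real b))) - poisson_integral b (log_trace 0)\<bar>
        \<le> 8 * ?H - 4 * (pi / X * ln (norm (G (of_real X))))"
      by linarith
  qed
qed

text \<open>The last hypothesis excludes \<open>G s = exp (- s)\<close>, whose modulus is \<open>1\<close> on the axis.\<close>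
theorem poisson_formula_half_plane:
  assumes nz: "\<And>s. Re s > 0 \<Longrightarrow> G s \<noteq> 0" and b: "b > 0"
    and mean_type: "\<And>\<eta>. \<eta> > 0 \<Longrightarrow> \<forall>\<^sub>F x in at_top. - \<eta> * x \<le> ln (norm (G (of_real x)))"
  shows "poisson_integral b (log_trace 0) = pi / b * ln (norm (G (of_real b)))"
proof -
  let ?d = "\<bar>pi / b * ln (norm (G (of_real b))) - poisson_integral b (log_trace 0)\<bar>"
  define H where "H A B X = poisson_integral X (log_bound A B)" for A B X :: real
  obtain A B where defect: "\<And>X. 0 < X \<Longrightarrow> ?d \<le> 8 * H A B X - 4 * (pi / X * ln (norm (G (of_real X))))"
    unfolding H_def using poisson_integral_defect_le[OF nz b] by blast
  have "?d \<le> 0 + \<delta>" if "\<delta> > 0" for \<delta>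
  proof -
    define \<eta> where "\<eta> = \<delta> / (8 + 4 * pi)"
    have \<eta>: "\<eta> > 0"
      using that by (simp add: \<eta>_def add_pos_pos)
    have "\<forall>\<^sub>F X in at_top. H A B X < \<eta>"
      using poisson_integral_log_bound_tendsto_0 \<eta> unfolding H_def by (rule order_tendstoD(2))
    then have "\<forall>\<^sub>F X in at_top. 0 < X \<and> H A B X < \<eta> \<and> - \<eta> * X \<le> ln (norm (G (of_real X)))"
      by (intro eventually_conj eventually_gt_at_top mean_type \<eta>)
    then obtain X where X: "0 < X" "H A B X < \<eta>" "- \<eta> * X \<le> ln (norm (G (of_real X)))"
      using eventually_happens'[OF trivial_limit_at_top_linorder] by blast
    have "- (pi * \<eta>) = pi / X * (- \<eta> * X)"
      using X(1) by simp
    also have "\<dots> \<le> pi / X * ln (norm (G (of_real X)))"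
      using X by (intro mult_left_mono) auto
    finally have "?d \<le> (8 + 4 * pi) * \<eta>"
      using defect[OF X(1)] X(2) unfolding distrib_right by linarith
    also have "\<dots> = \<delta>"
      using add_pos_pos[of 8 "4 * pi"] by (simp add: \<eta>_def)
    finally show ?thesis by simp
  qed
  then have "?d \<le> 0" by (rule field_le_epsilon)
  then show ?thesis by simp
qed

lemma factor_zero_bounded:
  assumes \<rho>: "Re \<rho> > 0" "G \<rho> = 0"
  obtains q B where "q holomorphic_on {s. Re s > a}" "\<And>s. G s = (s - \<rho>) * q s" "0 \<le> B"
    "\<And>s. Re s \<ge> 0 \<Longrightarrow> Re \<rho> * norm (q s) \<le> norm (G s) + B"
proof -
  define q where "q s = (if s = \<rho> then deriv G \<rho> else (G s - G \<rho>) / (s - \<rho>))" for s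
  have G_eq: "G s = (s - \<rho>) * q s" for s
    using \<rho>(2) by (simp add: q_def)
  have q: "q holomorphic_on {s. Re s > a}"
    unfolding q_def using \<rho>(1) a_neg
    by (intro pole_lemma_open holomorphic open_Re_gt)
  have "cball \<rho> (Re \<rho>) \<subseteq> {s. Re s > a}"
  proof
    fix s assume "s \<in> cball \<rho> (Re \<rho>)"
    then show "s \<in> {s. Re s > a}"
      using a_neg complex_Re_le_cmod[of "\<rho> - s"] by (simp add: dist_norm)
  qed
  then obtain B where B: "0 \<le> B" "\<And>s. s \<in> cball \<rho> (Re \<rho>) \<Longrightarrow> norm (q s) \<le> B"
    using continuous_on_compact_bound[OF compact_cball
        holomorphic_on_imp_continuous_on[OF holomorphic_on_subset[OF q]]]
    by metis
  have "Re \<rho> * norm (q s) \<le> norm (G s) + Re \<rho> * B" for s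
  proof (cases "s \<in> cball \<rho> (Re \<rho>)")
    case True
    then have "Re \<rho> * norm (q s) \<le> Re \<rho> * B"
      using B(2) \<rho>(1) by simp
    then show ?thesis by (simp add: add_increasing)
  next
    case False
    then have "Re \<rho> * norm (q s) \<le> norm (s - \<rho>) * norm (q s)"
      by (intro mult_right_mono) (auto simp: dist_norm norm_minus_commute)
    also have "\<dots> = norm (G s)"
      by (simp add: G_eq norm_mult)
    finally show ?thesis using B(1) \<rho>(1) by (simp add: add_increasing2)
  qed
  then show ?thesis
    using B(1) \<rho>(1) by (intro that[OF q G_eq, of "Re \<rho> * B"]) auto
qed

text \<open>Reflecting the zero in the imaginary axis keeps the modulus on the axis and increases it inside the
  half-plane.\<close>
lemma reflect_zero:
  assumes \<rho>: "Re \<rho> > 0" "G \<rho> = 0"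
  obtains R where "half_plane_function R a" "\<And>t. norm (R (\<i> * of_real t)) = norm (G (\<i> * of_real t))"
    "\<And>b. b > 0 \<Longrightarrow> G (of_real b) \<noteq> 0 \<Longrightarrow> norm (G (of_real b)) < norm (R (of_real b))"
proof -
  obtain q B where q: "q holomorphic_on {s. Re s > a}" and G_eq: "\<And>s. G s = (s - \<rho>) * q s"
    and B: "0 \<le> B" "\<And>s. Re s \<ge> 0 \<Longrightarrow> Re \<rho> * norm (q s) \<le> norm (G s) + B"
    using factor_zero_bounded[OF \<rho>] by metis
  obtain C K where bound: "\<And>s. s \<in> {s. Re s \<ge> 0} \<Longrightarrow> norm (G s) \<le> C * (1 + norm s) ^ K"
    by (rule polynomially_bounded_onE[OF polynomially_bounded]) (rule that)
  define R where "R s = (s + cnj \<rho>) * q s" for s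
  have R_le: "norm (R s) \<le> (3 * C + 2 * B) * (1 + norm s) ^ K" if "Re s \<ge> 0" for s
  proof -
    have "s + cnj \<rho> = (s - \<rho>) + of_real (2 * Re \<rho>)"
      by (simp add: complex_eq_iff)
    then have "R s = G s + of_real (2 * Re \<rho>) * q s"
      unfolding R_def G_eq by (simp only: distrib_right)
    then have "norm (R s) \<le> norm (G s) + 2 * (Re \<rho> * norm (q s))"
      using norm_triangle_ineq[of "G s" "of_real (2 * Re \<rho>) * q s"] \<rho>(1) by (simp add: norm_mult)
    also have "\<dots> \<le> 3 * norm (G s) + 2 * B * 1"
      using B(2)[OF that] by simp
    also have "\<dots> \<le> 3 * (C * (1 + norm s) ^ K) + 2 * B * (1 + norm s) ^ K"
      using B(1) that by (intro add_mono mult_left_mono bound) auto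
    finally show ?thesis by (simp add: algebra_simps)
  qed
  have "norm (\<i> * of_real t + cnj \<rho>) = norm (\<i> * of_real t - \<rho>)" for t
    using complex_mod_cnj[of "\<rho> - \<i> * of_real t"] by (simp add: norm_minus_commute add.commute)
  then have norm_axis: "norm (R (\<i> * of_real t)) = norm (G (\<i> * of_real t))" for t
    by (simp add: R_def G_eq norm_mult)
  have "norm (of_real b - \<rho>) < norm (of_real b + cnj \<rho>)" if "b > 0" for b
    using that \<rho>(1) by (simp add: cmod_def power2_eq_square algebra_simps)
  then have norm_less: "norm (G (of_real b)) < norm (R (of_real b))" if "b > 0" "G (of_real b) \<noteq> 0" for b
    using that by (simp add: R_def G_eq norm_mult)
  have "R holomorphic_on {s. Re s > a}"
    unfolding R_def by (intro holomorphic_intros q)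
  then have "half_plane_function R a"
    using R_le by unfold_locales (auto simp: polynomially_bounded_on_def intro: a_neg)
  then show ?thesis
    using norm_axis norm_less by (rule that)
qed

theorem jensen_half_plane_strict:
  assumes b: "b > 0" and nz: "G (of_real b) \<noteq> 0" and \<rho>: "Re \<rho> > 0" "G \<rho> = 0"
  shows "pi / b * ln (norm (G (of_real b))) < poisson_integral b (log_trace 0)"
proof -
  obtain R where R: "half_plane_function R a"
    and norm_axis: "\<And>t. norm (R (\<i> * of_real t)) = norm (G (\<i> * of_real t))"
    and norm_less: "norm (G (of_real b)) < norm (R (of_real b))"
    using reflect_zero[OF \<rho>] b nz by metis
  interpret R: half_plane_function R a
    by (rule R)
  have "0 < norm (G (of_real b))"
    using nz by simp
  then have "ln (norm (G (of_real b))) < ln (norm (R (of_real b)))"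
    using norm_less by (subst ln_less_cancel_iff) auto
  then have "pi / b * ln (norm (G (of_real b))) < pi / b * ln (norm (R (of_real b)))"
    using b by (intro mult_strict_left_mono) auto
  also have "\<dots> \<le> poisson_integral b (R.log_trace 0)"
    using norm_less by (intro R.jensen_half_plane(2) b) auto
  also have "R.log_trace 0 = log_trace 0"
    by (simp add: fun_eq_iff R.log_trace_def log_trace_def norm_axis)
  finally show ?thesis .
qed

theorem log_integral_eq_iff_zero_free:
  assumes b: "b > 0" and nz: "G (of_real b) \<noteq> 0"
    and mean_type: "\<And>\<eta>. \<eta> > 0 \<Longrightarrow> \<forall>\<^sub>F x in at_top. - \<eta> * x \<le> ln (norm (G (of_real x)))"
  shows "((\<lambda>t. ln (norm (G (\<i> * of_real t))) / (b\<^sup>2 + t\<^sup>2))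
      has_integral (pi / b * ln (norm (G (of_real b))))) UNIV
    \<longleftrightarrow> (\<forall>s. Re s > 0 \<longrightarrow> G s \<noteq> 0)"
proof -
  let ?I = "poisson_integral b (log_trace 0)" and ?c = "pi / b * ln (norm (G (of_real b)))"
  have integral: "((\<lambda>t. log_trace 0 t / (b\<^sup>2 + t\<^sup>2)) has_integral ?I) UNIV"
    by (rule has_integral_integral_lborel[OF jensen_half_plane(1)[OF b nz]])
  have "((\<lambda>t. log_trace 0 t / (b\<^sup>2 + t\<^sup>2)) has_integral ?c) UNIV \<longleftrightarrow> ?I = ?c"
  proof
    show "?I = ?c" if "((\<lambda>t. log_trace 0 t / (b\<^sup>2 + t\<^sup>2)) has_integral ?c) UNIV"
      using integral that by (rule has_integral_unique)
    show "((\<lambda>t. log_trace 0 t / (b\<^sup>2 + t\<^sup>2)) has_integral ?c) UNIV" if "?I = ?c"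
      using integral unfolding that .
  qed
  also have "\<dots> \<longleftrightarrow> (\<forall>s. Re s > 0 \<longrightarrow> G s \<noteq> 0)"
  proof
    assume "?I = ?c"
    then show "\<forall>s. Re s > 0 \<longrightarrow> G s \<noteq> 0"
      using jensen_half_plane_strict[OF b nz] by auto
  next
    assume "\<forall>s. Re s > 0 \<longrightarrow> G s \<noteq> 0"
    then show "?I = ?c"
      by (intro poisson_formula_half_plane b mean_type) auto
  qed
  finally show ?thesis
    by (simp only: log_trace_def shrink_0)
qed

end

section \<open>Analytic continuation and growth of the zeta function\<close>

definition dirichlet_zeta :: "complex \<Rightarrow> complex" where
  "dirichlet_zeta s = (\<Sum>n. 1 / of_nat (Suc n) powr s)"

lemma norm_inverse_Suc_powr: "norm (1 / (of_nat (Suc n) :: complex) powr s) = real (Suc n) powr (- Re s)"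
  using norm_powr_real_powr[of "of_nat (Suc n)" s]
  by (simp add: norm_divide powr_minus_divide del: of_nat_Suc)

lemma summable_Suc_powr: "p > 1 \<Longrightarrow> summable (\<lambda>n. real (Suc n) powr (- p))"
  using summable_Suc_iff[of "\<lambda>n. real n powr (- p)"] summable_real_powr_iff[of "-p"] by auto

lemma dirichlet_zeta_sums:
  assumes "Re s > 1"
  shows "(\<lambda>n. 1 / of_nat (Suc n) powr s) sums dirichlet_zeta s"
  unfolding dirichlet_zeta_def
proof (rule summable_sums, rule summable_norm_cancel)
  show "summable (\<lambda>n. norm (1 / (of_nat (Suc n) :: complex) powr s))"
    unfolding norm_inverse_Suc_powr by (rule summable_Suc_powr[OF assms])
qed

lemma gbinomial_Suc_mult:
  fixes a :: "'a::field_char_0"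
  shows "of_nat (Suc k) * (a gchoose Suc k) = (a - of_nat k) * (a gchoose k)"
  by (simp only: gbinomial_absorption gbinomial_absorb_comp)

lemma has_field_derivative_gbinomial_powr:
  fixes s z :: complex
  assumes "z \<notin> \<real>\<^sub>\<le>\<^sub>0"
  shows "((\<lambda>z. fact k * (s gchoose k) * z powr (s - of_nat k)) has_field_derivative
    fact (Suc k) * (s gchoose Suc k) * z powr (s - of_nat (Suc k))) (at z within A)"
proof -
  have "((\<lambda>z. fact k * (s gchoose k) * z powr (s - of_nat k)) has_field_derivative
      fact k * (s gchoose k) * ((s - of_nat k) * z powr (s - of_nat k - 1))) (at z within A)"
    using assms by (intro DERIV_cmult has_field_derivative_at_within[OF has_field_derivative_powr])
  also have "fact k * (s gchoose k) * ((s - of_nat k) * z powr (s - of_nat k - 1))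
      = fact k * ((s - of_nat k) * (s gchoose k)) * z powr (s - of_nat (Suc k))"
    by (simp add: mult_ac diff_diff_eq add.commute)
  also have "\<dots> = fact (Suc k) * (s gchoose Suc k) * z powr (s - of_nat (Suc k))"
    unfolding gbinomial_Suc_mult[symmetric] by (simp add: mult_ac)
  finally show ?thesis .
qed

lemma norm_powr_taylor_le:
  fixes s :: complex
  assumes x: "x > 0" and h: "h \<ge> 0" and s: "Re s \<le> real (Suc K)"
  shows "norm (of_real (x + h) powr s - (\<Sum>k\<le>K. (s gchoose k) * of_real x powr (s - of_nat k) * of_real h ^ k))
    \<le> real (Suc K) * norm (s gchoose Suc K) * x powr (Re s - real (Suc K)) * h ^ Suc K"
proof -
  define S where "S = complex_of_real ` {x..}"
  define f where "f k z = fact k * (s gchoose k) * z powr (s - of_nat k)" for k and z :: complex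
  have "norm (f 0 (of_real (x + h)) - (\<Sum>k\<le>K. f k (of_real x) * (of_real (x + h) - of_real x) ^ k / fact k))
      \<le> fact (Suc K) * norm (s gchoose Suc K) * x powr (Re s - real (Suc K))
        * norm (of_real (x + h) - of_real x :: complex) ^ Suc K / fact K"
  proof (rule field_Taylor[where S = S])
    show "convex S"
      unfolding S_def by (intro convex_linear_image bounded_linear.linear bounded_linear_of_real) auto
    show "of_real x \<in> S" "of_real (x + h) \<in> S"
      using h unfolding S_def by (intro imageI; simp)+
  next
    fix k z assume "z \<in> S"
    then show "(f k has_field_derivative f (Suc k) z) (at z within S)"
      unfolding f_def using x
      by (intro has_field_derivative_gbinomial_powr) (auto simp: S_def complex_nonpos_Reals_iff)
  next
    fix z assume "z \<in> S"
    then obtain y where y: "z = of_real y" "y \<ge> x" by (auto simp: S_def)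
    have "norm (z powr (s - of_nat (Suc K))) = y powr (Re s - real (Suc K))"
      using x y by (subst norm_powr_real_powr) auto
    also have "\<dots> \<le> x powr (Re s - real (Suc K))"
      using x y s by (intro powr_mono2') auto
    finally show "norm (f (Suc K) z) \<le> fact (Suc K) * norm (s gchoose Suc K) * x powr (Re s - real (Suc K))"
      unfolding f_def norm_mult norm_fact by (rule mult_left_mono) auto
  qed
  moreover have "f 0 (of_real (x + h)) = of_real (x + h) powr s"
    by (simp add: f_def)
  ultimately show ?thesis
    using h by (simp add: f_def mult_ac)
qed

text \<open>The remainder of the Taylor expansion of \<open>x powr (1 - s)\<close> between consecutive integers. Summing
  it over the integers telescopes and expresses \<open>(s - 1) \<zeta>(s)\<close> through \<open>\<zeta>(s + 1), \<zeta>(s + 2), \<dots>\<close>, which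
  extends \<open>\<zeta>\<close> by one strip to the left at each step.\<close>
definition zeta_taylor_rem :: "nat \<Rightarrow> complex \<Rightarrow> nat \<Rightarrow> complex" where
  "zeta_taylor_rem K s m = of_nat (Suc (Suc m)) powr (1 - s)
     - (\<Sum>k\<le>K. ((1 - s) gchoose k) * of_nat (Suc m) powr (1 - s - of_nat k))"

lemma norm_zeta_taylor_rem_le:
  assumes "- real K \<le> Re s"
  shows "norm (zeta_taylor_rem K s m) \<le> real (Suc K) * norm ((1 - s) gchoose Suc K)
      * real (Suc m) powr (- (Re s + real K))"
  using norm_powr_taylor_le[of "real (Suc m)" 1 "1 - s" K] assms
  by (simp add: zeta_taylor_rem_def algebra_simps)

lemma holomorphic_zeta_taylor_rem: "(\<lambda>s. zeta_taylor_rem K s m) holomorphic_on A"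
  unfolding zeta_taylor_rem_def gbinomial_prod_rev
  by (intro holomorphic_intros) (auto simp del: of_nat_Suc)

lemma norm_suminf_zeta_taylor_rem_le:
  assumes "Re s > 1 - real K"
  shows "norm (\<Sum>m. zeta_taylor_rem K s m)
    \<le> real (Suc K) * norm ((1 - s) gchoose Suc K) * (\<Sum>m. real (Suc m) powr (- (Re s + real K)))"
proof -
  have summable: "summable (\<lambda>m. real (Suc m) powr (- (Re s + real K)))"
    using assms by (intro summable_Suc_powr) simp
  have "norm (\<Sum>m. zeta_taylor_rem K s m)
      \<le> (\<Sum>m. real (Suc K) * norm ((1 - s) gchoose Suc K) * real (Suc m) powr (- (Re s + real K)))"
    using assms by (intro norm_suminf_le norm_zeta_taylor_rem_le summable_mult summable) simp
  then show ?thesis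
    by (simp only: suminf_mult[OF summable])
qed

lemma holomorphic_suminf:
  fixes f :: "nat \<Rightarrow> complex \<Rightarrow> complex"
  assumes S: "open S" and f: "\<And>n. f n holomorphic_on S"
    and bound: "\<And>z. z \<in> S \<Longrightarrow> \<exists>d>0. \<exists>M. summable M \<and> (\<forall>n. \<forall>w\<in>ball z d \<inter> S. norm (f n w) \<le> M n)"
  shows "(\<lambda>z. \<Sum>n. f n z) holomorphic_on S"
proof -
  have deriv: "(f n has_field_derivative deriv (f n) z) (at z)" if "z \<in> S" for n z
    using f S that by (rule holomorphic_derivI)
  have "\<exists>d M. 0 < d \<and> summable M \<and> (\<forall>\<^sub>F n in sequentially. \<forall>w\<in>ball z d \<inter> S. norm (f n w) \<le> M n)"
    if "z \<in> S" for z
    using bound[OF that] by (blast intro: always_eventually)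
  from series_and_derivative_comparison_local[OF S deriv this]
  obtain g g' where g: "\<And>z. z \<in> S \<Longrightarrow> (\<lambda>n. f n z) sums g z \<and> (g has_field_derivative g' z) (at z)"
    by blast
  then have "g holomorphic_on S"
    using S by (auto simp: holomorphic_on_open)
  then show ?thesis
    by (rule holomorphic_transform) (use g in \<open>simp add: sums_iff\<close>)
qed

lemma holomorphic_suminf_zeta_taylor_rem:
  "(\<lambda>s. \<Sum>m. zeta_taylor_rem K s m) holomorphic_on {s. Re s > 1 - real K}"
proof (rule holomorphic_suminf[OF open_Re_gt holomorphic_zeta_taylor_rem])
  fix s assume "s \<in> {s. Re s > 1 - real K}"
  define d where "d = (Re s - (1 - real K)) / 2"
  have d: "d > 0" "Re s - d + real K > 1"
    using \<open>s \<in> _\<close> by (auto simp: d_def field_simps)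
  have "continuous_on (cball s d) (\<lambda>w. (1 - w) gchoose Suc K)"
    unfolding gbinomial_prod_rev by (intro continuous_intros) (auto simp del: fact_Suc)
  then obtain B where B: "0 \<le> B" "\<And>w. w \<in> cball s d \<Longrightarrow> norm ((1 - w) gchoose Suc K) \<le> B"
    using continuous_on_compact_bound[OF compact_cball] by metis
  define M where "M m = real (Suc K) * B * real (Suc m) powr (- (Re s - d + real K))" for m
  have "summable M"
    unfolding M_def using d by (intro summable_mult summable_Suc_powr)
  moreover have "norm (zeta_taylor_rem K w n) \<le> M n" if w: "w \<in> ball s d" for w n
  proof -
    have Re_w: "Re s - d \<le> Re w"
      using w complex_Re_le_cmod[of "s - w"] by (simp add: dist_norm)
    have "norm (zeta_taylor_rem K w n) \<le> real (Suc K) * norm ((1 - w) gchoose Suc K)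
        * real (Suc n) powr (- (Re w + real K))"
      using Re_w d by (intro norm_zeta_taylor_rem_le) simp
    also have "\<dots> \<le> M n"
      unfolding M_def using w Re_w B by (intro mult_mono powr_mono) auto
    finally show ?thesis .
  qed
  ultimately show "\<exists>d>0. \<exists>M. summable M \<and> (\<forall>n. \<forall>w\<in>ball s d \<inter> {s. Re s > 1 - real K}.
      norm (zeta_taylor_rem K w n) \<le> M n)"
    using d(1) by blast
qed

lemma zeta_taylor_rem_sums:
  assumes s: "Re s > 1"
  shows "(\<lambda>m. zeta_taylor_rem K s m) sums
    (- 1 + (\<Sum>j<K. ((1 - s) gchoose j) / of_nat (Suc j) * ((s + of_nat j - 1) * dirichlet_zeta (s + of_nat j))))"
proof -
  have absorb: "((1 - s) gchoose Suc j) = - (((1 - s) gchoose j) / of_nat (Suc j) * (s + of_nat j - 1))" for j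
    using gbinomial_Suc_mult[of j "1 - s"] by (simp add: field_simps del: of_nat_Suc)
  define a where "a m = (of_nat (Suc m) :: complex) powr (1 - s)" for m
  have "norm (a m) = real (Suc m) powr (1 - Re s)" for m
    unfolding a_def by (subst norm_powr_real_powr) auto
  moreover have "(\<lambda>m. real (Suc m) powr (1 - Re s)) \<longlonglongrightarrow> 0"
    by (intro tendsto_neg_powr filterlim_compose[OF filterlim_real_sequentially filterlim_Suc]) (use s in auto)
  ultimately have "a \<longlonglongrightarrow> 0"
    by (intro tendsto_norm_zero_cancel[of a]) simp
  from telescope_sums[OF this] have telescope: "(\<lambda>m. a (Suc m) - a m) sums (- 1)"
    by (simp add: a_def)
  have "(\<lambda>m. of_nat (Suc m) powr (1 - s - of_nat (Suc j))) sums dirichlet_zeta (s + of_nat j)" for j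
  proof -
    have "1 - s - of_nat (Suc j) = - (s + of_nat j)" by simp
    then show ?thesis
      using dirichlet_zeta_sums[of "s + of_nat j"] s by (simp only: powr_minus_divide) simp
  qed
  then have "(\<lambda>m. (a (Suc m) - a m) -
      (\<Sum>j<K. ((1 - s) gchoose Suc j) * of_nat (Suc m) powr (1 - s - of_nat (Suc j))))
      sums (- 1 - (\<Sum>j<K. ((1 - s) gchoose Suc j) * dirichlet_zeta (s + of_nat j)))"
    by (intro sums_diff telescope sums_sum sums_mult)
  moreover have "zeta_taylor_rem K s = (\<lambda>m.
      (a (Suc m) - a m) - (\<Sum>j<K. ((1 - s) gchoose Suc j) * of_nat (Suc m) powr (1 - s - of_nat (Suc j))))"
    unfolding zeta_taylor_rem_def a_def sum.atMost_shift by (auto simp: fun_eq_iff)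
  moreover have "(\<Sum>j<K. ((1 - s) gchoose Suc j) * dirichlet_zeta (s + of_nat j))
      = - (\<Sum>j<K. ((1 - s) gchoose j) / of_nat (Suc j) * ((s + of_nat j - 1) * dirichlet_zeta (s + of_nat j)))"
    unfolding absorb sum_negf[symmetric] by (simp only: mult_minus_left mult.assoc)
  ultimately show ?thesis by simp
qed

lemma zeta_recurrence:
  assumes s: "Re s > 1"
  shows "(s - 1) * dirichlet_zeta s = 1 + (\<Sum>m. zeta_taylor_rem (Suc K) s m)
    - (\<Sum>j<K. ((1 - s) gchoose Suc j) / of_nat (Suc (Suc j)) *
        ((s + of_nat (Suc j) - 1) * dirichlet_zeta (s + of_nat (Suc j))))"
  using zeta_taylor_rem_sums[OF s, of "Suc K"] unfolding sum.lessThan_Suc_shift sums_iff by simp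

lemma zeta_continuation_half_plane:
  "\<exists>Z. Z holomorphic_on {s. Re s > - real K} \<and> (\<forall>s. Re s > 1 \<longrightarrow> Z s = (s - 1) * dirichlet_zeta s)"
proof (induction K)
  case 0
  have "(\<lambda>s. 1 + (\<Sum>m. zeta_taylor_rem 1 s m)) holomorphic_on {s. Re s > - real 0}"
    using holomorphic_suminf_zeta_taylor_rem[of 1] by (intro holomorphic_intros) simp
  then show ?case
    using zeta_recurrence[of _ 0] by (intro exI[of _ "\<lambda>s. 1 + (\<Sum>m. zeta_taylor_rem 1 s m)"]) auto
next
  case (Suc K)
  then obtain Z where Z: "Z holomorphic_on {s. Re s > - real K}"
    "\<And>s. Re s > 1 \<Longrightarrow> Z s = (s - 1) * dirichlet_zeta s" by auto
  let ?Z = "\<lambda>s. 1 + (\<Sum>m. zeta_taylor_rem (Suc (Suc K)) s m)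
    - (\<Sum>j<Suc K. ((1 - s) gchoose Suc j) / of_nat (Suc (Suc j)) * Z (s + of_nat (Suc j)))"
  have "(\<lambda>s. \<Sum>m. zeta_taylor_rem (Suc (Suc K)) s m) holomorphic_on {s. Re s > - real (Suc K)}"
    using holomorphic_suminf_zeta_taylor_rem[of "Suc (Suc K)"] by (rule holomorphic_on_subset) auto
  moreover have "(\<lambda>s. Z (s + of_nat (Suc j))) holomorphic_on {s. Re s > - real (Suc K)}" for j
    by (rule holomorphic_on_compose_gen[OF _ Z(1), unfolded o_def]) (auto intro!: holomorphic_intros)
  ultimately have "?Z holomorphic_on {s. Re s > - real (Suc K)}"
    unfolding gbinomial_prod_rev by (intro holomorphic_intros) auto
  moreover have "?Z s = (s - 1) * dirichlet_zeta s" if "Re s > 1" for s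
    using zeta_recurrence[OF that, of "Suc K"] Z(2) that by simp
  ultimately show ?case by blast
qed

lemma riemann_zeta_exists:
  "\<exists>f. f holomorphic_on (- {1}) \<and> (\<forall>s. Re s > 1 \<longrightarrow> f s = dirichlet_zeta s)"
proof -
  obtain Z where Z: "\<And>K. Z K holomorphic_on {s. Re s > - real K}"
    and Z_eq: "\<And>K s. Re s > 1 \<Longrightarrow> Z K s = (s - 1) * dirichlet_zeta s"
    using zeta_continuation_half_plane by metis
  have agree: "Z K s = Z L s" if "Re s > - real K" "Re s > - real L" for K L s
  proof (rule analytic_continuation_open[of "{s. Re s > 1}" "{s. Re s > - real (min K L)}" "Z K" "Z L"])
    show "{s. Re s > 1} \<noteq> {}" by (auto intro: exI[of _ 2])
    show "Z K holomorphic_on {s. Re s > - real (min K L)}"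
      by (rule holomorphic_on_subset[OF Z]) auto
    show "Z L holomorphic_on {s. Re s > - real (min K L)}"
      by (rule holomorphic_on_subset[OF Z]) auto
  qed (use that Z_eq in \<open>auto simp: open_Re_gt connected_Re_gt min_def\<close>)
  define N where "N s = nat \<lceil>- Re s\<rceil> + 1" for s
  have N: "Re s > - real (N s)" for s
    unfolding N_def by linarith
  define W where "W s = Z (N s) s" for s
  have "W holomorphic_on {s. Re s > - real K}" for K
    using Z[of K]
  proof (rule holomorphic_transform)
    show "Z K s = W s" if "s \<in> {s. Re s > - real K}" for s
      unfolding W_def by (rule agree) (use that N in auto)
  qed
  then have "W holomorphic_on (\<Union>K. {s. Re s > - real K})"
    by (intro holomorphic_on_UN_open open_Re_gt)
  also have "(\<Union>K. {s. Re s > - real K}) = UNIV"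
    using N by blast
  finally have "(\<lambda>s. W s / (s - 1)) holomorphic_on (- {1})"
    by (intro holomorphic_intros) (auto intro: holomorphic_on_subset)
  moreover have "W s / (s - 1) = dirichlet_zeta s" if "Re s > 1" for s
    using that by (auto simp: W_def Z_eq)
  ultimately show ?thesis by blast
qed

lemma holomorphic_riemann_zeta: "riemann_zeta holomorphic_on (- {1})"
  and riemann_zeta_eq_dirichlet: "Re s > 1 \<Longrightarrow> riemann_zeta s = dirichlet_zeta s"
  using someI_ex[OF riemann_zeta_exists] unfolding riemann_zeta_def dirichlet_zeta_def by blast+

definition zeta_reg :: "complex \<Rightarrow> complex" where
  "zeta_reg s = (if s = 1 then 1 else (s - 1) * riemann_zeta s)"

lemma zeta_reg_eq_suminf:
  assumes "Re s > 0"
  shows "zeta_reg s = 1 + (\<Sum>m. zeta_taylor_rem 1 s m)"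
proof (cases "s = 1")
  case True
  have "zeta_taylor_rem 1 1 m = 0" for m
    by (simp add: zeta_taylor_rem_def del: of_nat_Suc)
  then show ?thesis using True by (simp add: zeta_reg_def)
next
  case False
  have "(s - 1) * riemann_zeta s = 1 + (\<Sum>m. zeta_taylor_rem 1 s m)"
  proof (rule analytic_continuation_open[of "{s. Re s > 1}" "{s. Re s > 0} - {1}"
        "\<lambda>s. (s - 1) * riemann_zeta s" "\<lambda>s. 1 + (\<Sum>m. zeta_taylor_rem 1 s m)"])
    show "{s. Re s > 1} \<noteq> {}" by (auto intro: exI[of _ 2])
    show "connected ({s. 0 < Re s} - {1})"
      by (rule connected_open_delete[OF open_Re_gt connected_Re_gt]) simp
    show "(\<lambda>s. (s - 1) * riemann_zeta s) holomorphic_on {s. 0 < Re s} - {1}"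
      by (intro holomorphic_intros) (auto intro: holomorphic_on_subset[OF holomorphic_riemann_zeta])
    show "(\<lambda>s. 1 + (\<Sum>m. zeta_taylor_rem 1 s m)) holomorphic_on {s. 0 < Re s} - {1}"
      using holomorphic_suminf_zeta_taylor_rem[of 1]
      by (intro holomorphic_intros) (auto intro: holomorphic_on_subset)
    show "(z - 1) * riemann_zeta z = 1 + (\<Sum>m. zeta_taylor_rem 1 z m)" if "z \<in> {s. 1 < Re s}" for z
      using that zeta_recurrence[of z 0] by (simp add: riemann_zeta_eq_dirichlet)
  qed (use assms False in \<open>auto intro!: open_Re_gt open_Diff\<close>)
  then show ?thesis using False by (simp add: zeta_reg_def)
qed

lemma holomorphic_zeta_reg: "zeta_reg holomorphic_on {s. Re s > 0}"
proof (rule holomorphic_transform)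
  show "(\<lambda>s. 1 + (\<Sum>m. zeta_taylor_rem 1 s m)) holomorphic_on {s. Re s > 0}"
    using holomorphic_suminf_zeta_taylor_rem[of 1] by (intro holomorphic_intros) simp
qed (simp add: zeta_reg_eq_suminf)

lemma polynomially_bounded_on_zeta_reg:
  assumes \<sigma>: "\<sigma> > 0"
  shows "polynomially_bounded_on zeta_reg {s. Re s \<ge> \<sigma>}"
proof -
  define B where "B = (\<Sum>m. real (Suc m) powr (- (\<sigma> + 1)))"
  have B: "B \<ge> 0"
    unfolding B_def using \<sigma> by (intro suminf_nonneg summable_Suc_powr) auto
  have "norm (zeta_reg s) \<le> (1 + B) * (1 + norm s) ^ 2" if s: "Re s \<ge> \<sigma>" for s
  proof -
    have "norm (zeta_reg s) \<le> 1 + norm (\<Sum>m. zeta_taylor_rem 1 s m)"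
      using s \<sigma> norm_triangle_ineq[of 1 "\<Sum>m. zeta_taylor_rem 1 s m"] by (simp add: zeta_reg_eq_suminf)
    also have "norm (\<Sum>m. zeta_taylor_rem 1 s m) \<le> norm ((1 - s) * s) * (\<Sum>m. real (Suc m) powr (- (Re s + 1)))"
    proof -
      have "real (Suc 1) * norm ((1 - s) gchoose Suc 1) = norm (of_nat (Suc 1) * ((1 - s) gchoose Suc 1))"
        by (simp only: norm_mult norm_of_nat)
      also have "\<dots> = norm ((1 - s) * s)"
        unfolding gbinomial_Suc_mult by (simp add: norm_mult)
      finally show ?thesis
        using norm_suminf_zeta_taylor_rem_le[of 1 s] s \<sigma> by simp
    qed
    also have "\<dots> \<le> norm ((1 - s) * s) * B"
      unfolding B_def
      by (intro mult_left_mono suminf_le powr_mono summable_Suc_powr) (use s \<sigma> in auto)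
    also have "norm ((1 - s) * s) \<le> (1 + norm s) * (1 + norm s)"
      unfolding norm_mult using norm_triangle_ineq4[of 1 s] by (intro mult_mono) auto
    also have "1 + (1 + norm s) * (1 + norm s) * B \<le> (1 + B) * (1 + norm s) ^ 2"
      by (simp add: power2_eq_square algebra_simps)
    finally show ?thesis using B by (simp add: mult_right_mono)
  qed
  then show ?thesis
    unfolding polynomially_bounded_on_def by blast
qed

lemma norm_dirichlet_zeta_of_real_ge_1:
  assumes "x > 1"
  shows "1 \<le> norm (dirichlet_zeta (of_real x))"
proof -
  have "(of_nat (Suc n) :: complex) powr of_real x = of_real (real (Suc n) powr x)" for n
    using powr_of_real[of "real (Suc n)" x] by (simp only: of_real_of_nat_eq of_nat_0_le_iff)
  then have "1 / (of_nat (Suc n) :: complex) powr of_real x = of_real (real (Suc n) powr (- x))" for n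
    by (simp only: powr_minus_divide of_real_divide of_real_1)
  then have "dirichlet_zeta (of_real x) = of_real (\<Sum>n. real (Suc n) powr (- x))"
    using assms by (simp only: dirichlet_zeta_def suminf_of_real summable_Suc_powr)
  moreover have "(\<Sum>n\<in>{0}. real (Suc n) powr (- x)) \<le> (\<Sum>n. real (Suc n) powr (- x))"
    using assms by (intro sum_le_suminf summable_Suc_powr) auto
  ultimately show ?thesis by simp
qed

lemma norm_zeta_reg_of_real_ge_1:
  assumes "x \<ge> 2"
  shows "1 \<le> norm (zeta_reg (of_real x))"
proof -
  have "norm (of_real (x - 1) :: complex) = x - 1"
    using assms by (simp only: norm_of_real)
  then have "norm (complex_of_real x - 1) = x - 1"
    by simp
  moreover have "1 * 1 \<le> (x - 1) * norm (dirichlet_zeta (of_real x))"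
    using assms by (intro mult_mono norm_dirichlet_zeta_of_real_ge_1) auto
  ultimately show ?thesis
    using assms by (auto simp: zeta_reg_def norm_mult riemann_zeta_eq_dirichlet)
qed

lemma half_plane_function_zeta_reg:
  assumes "\<sigma> > 0"
  shows "half_plane_function (\<lambda>w. zeta_reg (of_real \<sigma> + w)) (- \<sigma>)"
proof
  show "(\<lambda>w. zeta_reg (of_real \<sigma> + w)) holomorphic_on {w. Re w > - \<sigma>}"
    by (rule holomorphic_on_compose_gen[OF _ holomorphic_zeta_reg, unfolded o_def])
      (auto intro!: holomorphic_intros)
  show "polynomially_bounded_on (\<lambda>w. zeta_reg (of_real \<sigma> + w)) {w. Re w \<ge> 0}"
    using polynomially_bounded_on_zeta_reg[OF assms]
    by (intro polynomially_bounded_on_translate) (auto elim: polynomially_bounded_on_subset)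
qed (use assms in simp)

lemma zeta_log_integral_eq_0_iff:
  assumes \<sigma>: "0 < \<sigma>" "\<sigma> < 1"
  shows "((\<lambda>t. ln (norm (zeta_reg (Complex \<sigma> t))) / ((1 - \<sigma>)\<^sup>2 + t\<^sup>2)) has_integral 0) UNIV
    \<longleftrightarrow> (\<forall>s. Re s > \<sigma> \<longrightarrow> zeta_reg s \<noteq> 0)"
proof -
  define G where "G = (\<lambda>w. zeta_reg (of_real \<sigma> + w))"
  interpret G: half_plane_function G "- \<sigma>"
    unfolding G_def by (rule half_plane_function_zeta_reg[OF \<sigma>(1)])
  have "G (of_real (1 - \<sigma>)) = 1"
    by (simp add: G_def zeta_reg_def)
  moreover have "\<forall>\<^sub>F x in at_top. - \<eta> * x \<le> ln (norm (G (of_real x)))" if "\<eta> > 0" for \<eta>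
    using eventually_ge_at_top[of 2]
  proof eventually_elim
    case (elim x)
    have "- \<eta> * x \<le> 0"
      using elim that by simp
    also have "\<dots> \<le> ln (norm (zeta_reg (of_real (\<sigma> + x))))"
      using elim \<sigma> by (intro ln_ge_zero norm_zeta_reg_of_real_ge_1) simp
    finally show ?case by (simp add: G_def)
  qed
  moreover have "Complex \<sigma> t = of_real \<sigma> + \<i> * of_real t" for t
    by (simp add: complex_eq_iff)
  ultimately have "((\<lambda>t. ln (norm (zeta_reg (Complex \<sigma> t))) / ((1 - \<sigma>)\<^sup>2 + t\<^sup>2)) has_integral 0) UNIV
      \<longleftrightarrow> (\<forall>w. Re w > 0 \<longrightarrow> zeta_reg (of_real \<sigma> + w) \<noteq> 0)"
    using G.log_integral_eq_iff_zero_free[of "1 - \<sigma>"] \<sigma> by (simp add: G_def)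
  also have "\<dots> \<longleftrightarrow> (\<forall>s. Re s > \<sigma> \<longrightarrow> zeta_reg s \<noteq> 0)"
  proof (intro iffI allI impI)
    fix s
    assume nz: "\<forall>w. Re w > 0 \<longrightarrow> zeta_reg (of_real \<sigma> + w) \<noteq> 0" and "Re s > \<sigma>"
    then have "zeta_reg (of_real \<sigma> + (s - of_real \<sigma>)) \<noteq> 0"
      by (intro nz[rule_format]) simp
    then show "zeta_reg s \<noteq> 0" by simp
  qed simp
  finally show ?thesis .
qed

theorem theorem4:
  fixes \<alpha> :: real
  assumes "0 \<le> \<alpha>" and "\<alpha> < 1/2"
  shows "((\<lambda>t::real. ln (cmod (riemann_zeta (Complex (1/2 + \<alpha>) t) * Complex (-1/2 + \<alpha>) t))
                        / ((1/2 - \<alpha>)\<^sup>2 + t\<^sup>2)) has_integral 0) UNIV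
         \<longleftrightarrow> (\<forall>s. s \<noteq> 1 \<and> Re s > 1/2 + \<alpha> \<longrightarrow> riemann_zeta s \<noteq> 0)"
proof -
  define \<sigma> where "\<sigma> = 1/2 + \<alpha>"
  have \<sigma>: "0 < \<sigma>" "\<sigma> < 1"
    using assms by (auto simp: \<sigma>_def)
  have "riemann_zeta (Complex \<sigma> t) * Complex (-1/2 + \<alpha>) t = zeta_reg (Complex \<sigma> t)" for t
  proof -
    have "Complex (-1/2 + \<alpha>) t = Complex \<sigma> t - 1" "Complex \<sigma> t \<noteq> 1"
      using \<sigma> by (auto simp: complex_eq_iff \<sigma>_def)
    then show ?thesis by (simp add: zeta_reg_def)
  qed
  moreover have "1/2 - \<alpha> = 1 - \<sigma>"
    by (simp add: \<sigma>_def)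
  moreover have "(\<forall>s. Re s > \<sigma> \<longrightarrow> zeta_reg s \<noteq> 0) \<longleftrightarrow> (\<forall>s. s \<noteq> 1 \<and> Re s > \<sigma> \<longrightarrow> riemann_zeta s \<noteq> 0)"
    by (auto simp: zeta_reg_def)
  ultimately show ?thesis
    using zeta_log_integral_eq_0_iff[OF \<sigma>] by (simp only: \<sigma>_def[symmetric])
qed

end
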